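(* Let $\mathbf{C}$ be a pointed, well-powered and finitely complete category with arbitrary intersections of subobjects, and let $\tau(\mathbf{C})$ be a pullback-stable full subcategory of the category of internal binary relations in $\mathbf{C}$, closed under arbitrary intersections. Then the normalization functor $N\colon \tau(\mathbf{C})\to \mathbf{Mono}(\mathbf{C})$ has a left adjoint $F\colon \mathbf{Mono}(\mathbf{C})\to\tau(\mathbf{C})$, defined on objects by $F(m\colon M\to A)=(R,r)$ with $(R,r)=\bigcap \mathbf{S}_m$, where $\mathbf{S}_m$ is the set of all $\tau$-relations on $A$ (i.e. relations on $A$ belonging to $\tau(\mathbf{C})$) through which $\langle 0,1\rangle m\colon M\to A\times A$ factors.
   Context: An internal binary relation on an object $A$ of $\mathbf{C}$ is a subobject $r\colon R\to A\times A$. The category of internal relations in $\mathbf{C}$ has as objects the pairs consisting of an object $A$ and a relation $(R,r)$ on $A$; a morphism from $(A,R,r)$ to $(A',R',r')$ is a morphism $f\colon A\to A'$ of $\mathbf{C}$ compatible with the relations, i.e. such that $(f\times f)r$ factors through $r'$. The full subcategory $\tau(\mathbf{C})$ of relations "of type $\tau$" is pullback-stable if, for each $f\colon A\to A'$ in $\mathbf{C}$ and each relation $(R',r')$ on $A'$ in $\tau(\mathbf{C})$, the pullback of $r'$ along $f\times f\colon A\times A\to A'\times A'$ is a relation on $A$ in $\tau(\mathbf{C})$. It is closed under arbitrary intersections if, for each object $A$, the intersection of any family of relations on $A$ in $\tau(\mathbf{C})$ is in $\tau(\mathbf{C})$; this includes the empty intersection, so the indiscrete relation $\nabla_A=A\times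 A$ belongs to $\tau(\mathbf{C})$. $\mathbf{Mono}(\mathbf{C})$ is the category whose objects are the monomorphisms of $\mathbf{C}$ and whose morphisms are commutative squares. Arbitrary intersections means generalized pullbacks of (families of) monomorphisms with common codomain. $\langle 0,1\rangle\colon A\to A\times A$ is the morphism with components the zero morphism and the identity. The normalization functor $N$ sends a relation $(R,r)$ on $A$ to the monomorphism $m\colon M\to A$ obtained as the pullback of $r\colon R\to A\times A$ along $\langle 0,1\rangle\colon A\to A\times A$; on morphisms it is defined by the universal property of pullbacks. *)

theory Defs
  imports Main
begin

section \<open>Categories and functors\<close>

record ('o, 'a) cat =
  Obj :: "'o set"
  Arr :: "'a set"
  Dom :: "'a \<Rightarrow> 'o"
  Cod :: "'a \<Rightarrow> 'o"
  Ident :: "'o \<Rightarrow> 'a"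
  Comp :: "'a \<Rightarrow> 'a \<Rightarrow> 'a" (infixl "\<cdot>\<index>" 70)

definition hom :: "('o, 'a) cat \<Rightarrow> 'o \<Rightarrow> 'o \<Rightarrow> 'a set" where
  "hom C A B = {f \<in> Arr C. Dom C f = A \<and> Cod C f = B}"

locale category =
  fixes C :: "('o, 'a) cat" (structure)
  assumes dom_closed: "f \<in> Arr C \<Longrightarrow> Dom C f \<in> Obj C"
    and cod_closed: "f \<in> Arr C \<Longrightarrow> Cod C f \<in> Obj C"
    and ident_hom: "A \<in> Obj C \<Longrightarrow> Ident C A \<in> hom C A A"
    and comp_hom: "f \<in> hom C A B \<Longrightarrow> g \<in> hom C B D \<Longrightarrow> g \<cdot> f \<in> hom C A D"
    and ident_left: "f \<in> hom C A B \<Longrightarrow> Ident C B \<cdot> f = f"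
    and ident_right: "f \<in> hom C A B \<Longrightarrow> f \<cdot> Ident C A = f"
    and comp_assoc: "f \<in> hom C A B \<Longrightarrow> g \<in> hom C B D \<Longrightarrow> h \<in> hom C D E \<Longrightarrow>
      (h \<cdot> g) \<cdot> f = h \<cdot> (g \<cdot> f)"

definition full_subcat :: "('o, 'a) cat \<Rightarrow> 'o set \<Rightarrow> ('o, 'a) cat" where
  "full_subcat C T =
     C\<lparr>Obj := T, Arr := {f \<in> Arr C. Dom C f \<in> T \<and> Cod C f \<in> T}\<rparr>"

record ('o, 'a, 'p, 'b) func =
  omap :: "'o \<Rightarrow> 'p"
  amap :: "'a \<Rightarrow> 'b"

definition is_functor ::
    "('o, 'a) cat \<Rightarrow> ('p, 'b) cat \<Rightarrow> ('o, 'a, 'p, 'b) func \<Rightarrow> bool" where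
  "is_functor C D F \<longleftrightarrow> category C \<and> category D \<and>
     (\<forall>A\<in>Obj C. omap F A \<in> Obj D) \<and>
     (\<forall>A B. \<forall>f\<in>hom C A B. amap F f \<in> hom D (omap F A) (omap F B)) \<and>
     (\<forall>A\<in>Obj C. amap F (Ident C A) = Ident D (omap F A)) \<and>
     (\<forall>A B E. \<forall>f\<in>hom C A B. \<forall>g\<in>hom C B E.
        amap F (g \<cdot>\<^bsub>C\<^esub> f) = amap F g \<cdot>\<^bsub>D\<^esub> amap F f)"

text \<open>\<open>left_adjoint C D F G\<close>: the functor \<open>F : C \<rightarrow> D\<close> is left adjoint to \<open>G : D \<rightarrow> C\<close>,
  via a bijection \<open>\<phi> X Y : D(F X, Y) \<rightarrow> C(X, G Y)\<close> natural in both variables.\<close>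

definition left_adjoint ::
    "('o, 'a) cat \<Rightarrow> ('p, 'b) cat \<Rightarrow> ('o, 'a, 'p, 'b) func \<Rightarrow> ('p, 'b, 'o, 'a) func \<Rightarrow> bool" where
  "left_adjoint C D F G \<longleftrightarrow> is_functor C D F \<and> is_functor D C G \<and>
     (\<exists>\<phi>. (\<forall>X\<in>Obj C. \<forall>Y\<in>Obj D.
             bij_betw (\<phi> X Y) (hom D (omap F X) Y) (hom C X (omap G Y))) \<and>
          (\<forall>X\<in>Obj C. \<forall>X'\<in>Obj C. \<forall>Y\<in>Obj D. \<forall>Y'\<in>Obj D.
             \<forall>u\<in>hom C X' X. \<forall>v\<in>hom D Y Y'. \<forall>f\<in>hom D (omap F X) Y.
               \<phi> X' Y' (v \<cdot>\<^bsub>D\<^esub> f \<cdot>\<^bsub>D\<^esub> amap F u) = amap G v \<cdot>\<^bsub>C\<^esub> \<phi> X Y f \<cdot>\<^bsub>C\<^esub> u))"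

section \<open>Limits\<close>

definition is_cone ::
    "('j, 'k) cat \<Rightarrow> ('o, 'a) cat \<Rightarrow> ('j, 'k, 'o, 'a) func \<Rightarrow> 'o \<Rightarrow> ('j \<Rightarrow> 'a) \<Rightarrow> bool" where
  "is_cone J C D X \<xi> \<longleftrightarrow> X \<in> Obj C \<and>
     (\<forall>j\<in>Obj J. \<xi> j \<in> hom C X (omap D j)) \<and>
     (\<forall>u\<in>Arr J. amap D u \<cdot>\<^bsub>C\<^esub> \<xi> (Dom J u) = \<xi> (Cod J u))"

definition is_limit ::
    "('j, 'k) cat \<Rightarrow> ('o, 'a) cat \<Rightarrow> ('j, 'k, 'o, 'a) func \<Rightarrow> 'o \<Rightarrow> ('j \<Rightarrow> 'a) \<Rightarrow> bool" where
  "is_limit J C D L \<pi> \<longleftrightarrow> is_cone J C D L \<pi> \<and>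
     (\<forall>X \<xi>. is_cone J C D X \<xi> \<longrightarrow>
        (\<exists>!h. h \<in> hom C X L \<and> (\<forall>j\<in>Obj J. \<pi> j \<cdot>\<^bsub>C\<^esub> h = \<xi> j)))"

text \<open>Every finite category is isomorphic to one whose objects and arrows are natural numbers,
  so these suffice as shapes.\<close>

definition finitely_complete :: "('o, 'a) cat \<Rightarrow> bool" where
  "finitely_complete C \<longleftrightarrow>
     (\<forall>(J :: (nat, nat) cat) D. finite (Obj J) \<and> finite (Arr J) \<and> is_functor J C D \<longrightarrow>
        (\<exists>L \<pi>. is_limit J C D L \<pi>))"

definition is_product :: "('o, 'a) cat \<Rightarrow> 'o \<Rightarrow> 'o \<Rightarrow> 'o \<Rightarrow> 'a \<Rightarrow> 'a \<Rightarrow> bool" where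
  "is_product C A B P p q \<longleftrightarrow> p \<in> hom C P A \<and> q \<in> hom C P B \<and>
     (\<forall>X. \<forall>f\<in>hom C X A. \<forall>g\<in>hom C X B.
        \<exists>!h. h \<in> hom C X P \<and> p \<cdot>\<^bsub>C\<^esub> h = f \<and> q \<cdot>\<^bsub>C\<^esub> h = g)"

text \<open>\<open>is_pullback C f g p q\<close>: the square \<open>f \<cdot> p = g \<cdot> q\<close> is a pullback; \<open>p\<close> is the pullback
  of \<open>g\<close> along \<open>f\<close>.\<close>

definition is_pullback :: "('o, 'a) cat \<Rightarrow> 'a \<Rightarrow> 'a \<Rightarrow> 'a \<Rightarrow> 'a \<Rightarrow> bool" where
  "is_pullback C f g p q \<longleftrightarrow> f \<in> Arr C \<and> g \<in> Arr C \<and> Cod C f = Cod C g \<and>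
     p \<in> hom C (Dom C p) (Dom C f) \<and> q \<in> hom C (Dom C p) (Dom C g) \<and>
     f \<cdot>\<^bsub>C\<^esub> p = g \<cdot>\<^bsub>C\<^esub> q \<and>
     (\<forall>X. \<forall>u\<in>hom C X (Dom C f). \<forall>v\<in>hom C X (Dom C g). f \<cdot>\<^bsub>C\<^esub> u = g \<cdot>\<^bsub>C\<^esub> v \<longrightarrow>
        (\<exists>!h. h \<in> hom C X (Dom C p) \<and> p \<cdot>\<^bsub>C\<^esub> h = u \<and> q \<cdot>\<^bsub>C\<^esub> h = v))"

text \<open>A chosen product \<open>(A \<times> B, pr1, pr2)\<close>, with the induced operations on arrows.\<close>

definition product_cone :: "('o, 'a) cat \<Rightarrow> 'o \<Rightarrow> 'o \<Rightarrow> 'o \<times> 'a \<times> 'a" where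
  "product_cone C A B = (SOME (P, p, q). is_product C A B P p q)"

definition prd :: "('o, 'a) cat \<Rightarrow> 'o \<Rightarrow> 'o \<Rightarrow> 'o" where
  "prd C A B = fst (product_cone C A B)"

definition pr1 :: "('o, 'a) cat \<Rightarrow> 'o \<Rightarrow> 'o \<Rightarrow> 'a" where
  "pr1 C A B = fst (snd (product_cone C A B))"

definition pr2 :: "('o, 'a) cat \<Rightarrow> 'o \<Rightarrow> 'o \<Rightarrow> 'a" where
  "pr2 C A B = snd (snd (product_cone C A B))"

definition pairing :: "('o, 'a) cat \<Rightarrow> 'a \<Rightarrow> 'a \<Rightarrow> 'a" where
  "pairing C f g = (THE h. h \<in> hom C (Dom C f) (prd C (Cod C f) (Cod C g)) \<and>
     pr1 C (Cod C f) (Cod C g) \<cdot>\<^bsub>C\<^esub> h = f \<and> pr2 C (Cod C f) (Cod C g) \<cdot>\<^bsub>C\<^esub> h = g)"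

definition prod_map :: "('o, 'a) cat \<Rightarrow> 'a \<Rightarrow> 'a \<Rightarrow> 'a" where
  "prod_map C f g = pairing C (f \<cdot>\<^bsub>C\<^esub> pr1 C (Dom C f) (Dom C g)) (g \<cdot>\<^bsub>C\<^esub> pr2 C (Dom C f) (Dom C g))"

section \<open>Zero morphisms\<close>

definition zero_object :: "('o, 'a) cat \<Rightarrow> 'o \<Rightarrow> bool" where
  "zero_object C Z \<longleftrightarrow> Z \<in> Obj C \<and>
     (\<forall>X\<in>Obj C. (\<exists>!f. f \<in> hom C X Z) \<and> (\<exists>!f. f \<in> hom C Z X))"

definition pointed :: "('o, 'a) cat \<Rightarrow> bool" where
  "pointed C \<longleftrightarrow> (\<exists>Z. zero_object C Z)"

definition zero_arr :: "('o, 'a) cat \<Rightarrow> 'o \<Rightarrow> 'o \<Rightarrow> 'a" where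
  "zero_arr C A B = (THE f. \<exists>Z. zero_object C Z \<and>
     (\<exists>u\<in>hom C A Z. \<exists>v\<in>hom C Z B. f = v \<cdot>\<^bsub>C\<^esub> u))"

definition zero_one :: "('o, 'a) cat \<Rightarrow> 'o \<Rightarrow> 'a" where
  "zero_one C A = pairing C (zero_arr C A A) (Ident C A)"

section \<open>Subobjects and intersections\<close>

definition is_mono :: "('o, 'a) cat \<Rightarrow> 'a \<Rightarrow> bool" where
  "is_mono C m \<longleftrightarrow> m \<in> Arr C \<and>
     (\<forall>X. \<forall>f\<in>hom C X (Dom C m). \<forall>g\<in>hom C X (Dom C m). m \<cdot>\<^bsub>C\<^esub> f = m \<cdot>\<^bsub>C\<^esub> g \<longrightarrow> f = g)"

definition factors_through :: "('o, 'a) cat \<Rightarrow> 'a \<Rightarrow> 'a \<Rightarrow> bool" where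
  "factors_through C f g \<longleftrightarrow> (\<exists>h\<in>hom C (Dom C f) (Dom C g). f = g \<cdot>\<^bsub>C\<^esub> h)"

definition monos_into :: "('o, 'a) cat \<Rightarrow> 'o \<Rightarrow> 'a set" where
  "monos_into C A = {m. is_mono C m \<and> Cod C m = A}"

definition subobjects :: "('o, 'a) cat \<Rightarrow> 'o \<Rightarrow> 'a set set" where
  "subobjects C A = monos_into C A // {(m, n). m \<in> monos_into C A \<and> n \<in> monos_into C A \<and>
     factors_through C m n \<and> factors_through C n m}"

text \<open>The distinction between sets and classes is expressed by a collection \<open>U\<close> of small index
  sets, of which only closure under subsets is needed.  For a Grothendieck universe one may take
  the sets of cardinality below its rank; \<open>U = UNIV\<close> is the reading in which the members of
  \<open>'i set\<close> are the small sets.\<close>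

definition smallness :: "'i set set \<Rightarrow> bool" where
  "smallness U \<longleftrightarrow> {} \<in> U \<and> (\<forall>I\<in>U. \<forall>J. J \<subseteq> I \<longrightarrow> J \<in> U)"

definition well_powered :: "'i set set \<Rightarrow> ('o, 'a) cat \<Rightarrow> bool" where
  "well_powered U C \<longleftrightarrow> (\<forall>A\<in>Obj C. \<exists>I\<in>U. \<exists>s. bij_betw s I (subobjects C A))"

text \<open>Generalized pullback \<open>k\<close>, with projections \<open>p i\<close>, of a family \<open>m i\<close> of arrows with common
  codomain \<open>A\<close>; for the empty family this is an isomorphism onto \<open>A\<close>.\<close>

definition is_wide_pullback ::
    "('o, 'a) cat \<Rightarrow> 'o \<Rightarrow> 'i set \<Rightarrow> ('i \<Rightarrow> 'a) \<Rightarrow> 'a \<Rightarrow> ('i \<Rightarrow> 'a) \<Rightarrow> bool" where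
  "is_wide_pullback C A I m k p \<longleftrightarrow> k \<in> hom C (Dom C k) A \<and>
     (\<forall>i\<in>I. p i \<in> hom C (Dom C k) (Dom C (m i)) \<and> m i \<cdot>\<^bsub>C\<^esub> p i = k) \<and>
     (\<forall>X f q. f \<in> hom C X A \<and>
        (\<forall>i\<in>I. q i \<in> hom C X (Dom C (m i)) \<and> m i \<cdot>\<^bsub>C\<^esub> q i = f) \<longrightarrow>
        (\<exists>!h. h \<in> hom C X (Dom C k) \<and> k \<cdot>\<^bsub>C\<^esub> h = f \<and> (\<forall>i\<in>I. p i \<cdot>\<^bsub>C\<^esub> h = q i)))"

definition is_intersection ::
    "('o, 'a) cat \<Rightarrow> 'o \<Rightarrow> 'i set \<Rightarrow> ('i \<Rightarrow> 'a) \<Rightarrow> 'a \<Rightarrow> bool" where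
  "is_intersection C A I m k \<longleftrightarrow>
     m ` I \<subseteq> monos_into C A \<and> (\<exists>p. is_wide_pullback C A I m k p)"

definition has_intersections :: "'i set set \<Rightarrow> ('o, 'a) cat \<Rightarrow> bool" where
  "has_intersections U C \<longleftrightarrow> (\<forall>A\<in>Obj C. \<forall>I\<in>U. \<forall>m. m ` I \<subseteq> monos_into C A \<longrightarrow>
     (\<exists>k. is_intersection C A I m k))"

section \<open>Internal relations and normalization\<close>

definition mono_cat :: "('o, 'a) cat \<Rightarrow> ('a, 'a \<times> 'a \<times> 'a \<times> 'a) cat" where
  "mono_cat C =
     \<lparr>Obj = {m. is_mono C m},
      Arr = {(m, m', g, f). is_mono C m \<and> is_mono C m' \<and>
               g \<in> hom C (Dom C m) (Dom C m') \<and> f \<in> hom C (Cod C m) (Cod C m') \<and>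
               f \<cdot>\<^bsub>C\<^esub> m = m' \<cdot>\<^bsub>C\<^esub> g},
      Dom = (\<lambda>(m, m', g, f). m),
      Cod = (\<lambda>(m, m', g, f). m'),
      Ident = (\<lambda>m. (m, m, Ident C (Dom C m), Ident C (Cod C m))),
      Comp = (\<lambda>(m', m'', g', f') (m, _, g, f). (m, m'', g' \<cdot>\<^bsub>C\<^esub> g, f' \<cdot>\<^bsub>C\<^esub> f))\<rparr>"

text \<open>The relation \<open>r : R \<rightarrow> A \<times> A\<close> on \<open>A\<close> is represented by the pair \<open>(A, r)\<close>, where \<open>R\<close> is the
  domain of \<open>r\<close>.  The component \<open>A\<close> is kept since it may not be determined by the object \<open>A \<times> A\<close>.\<close>

definition rel_cat :: "('o, 'a) cat \<Rightarrow> ('o \<times> 'a, ('o \<times> 'a) \<times> ('o \<times> 'a) \<times> 'a) cat" where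
  "rel_cat C = (let Rels = {(A, r). A \<in> Obj C \<and> r \<in> monos_into C (prd C A A)} in
     \<lparr>Obj = Rels,
      Arr = {((A, r), (A', r'), f). (A, r) \<in> Rels \<and> (A', r') \<in> Rels \<and> f \<in> hom C A A' \<and>
               factors_through C (prod_map C f f \<cdot>\<^bsub>C\<^esub> r) r'},
      Dom = (\<lambda>(X, Y, f). X),
      Cod = (\<lambda>(X, Y, f). Y),
      Ident = (\<lambda>(A, r). ((A, r), (A, r), Ident C A)),
      Comp = (\<lambda>(Y, Z, g) (X, _, f). (X, Z, g \<cdot>\<^bsub>C\<^esub> f))\<rparr>)"

text \<open>A full subcategory of \<open>rel_cat C\<close> is given by a set \<open>T\<close> of objects.  Quantifying over all
  pullbacks, respectively all intersections, makes \<open>T\<close> independent of the monomorphism chosen to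
  represent a subobject.\<close>

definition pullback_stable :: "('o, 'a) cat \<Rightarrow> ('o \<times> 'a) set \<Rightarrow> bool" where
  "pullback_stable C T \<longleftrightarrow>
     (\<forall>A A' f r' r q. f \<in> hom C A A' \<and> (A', r') \<in> T \<and>
        is_pullback C (prod_map C f f) r' r q \<longrightarrow> (A, r) \<in> T)"

definition intersection_closed :: "'i set set \<Rightarrow> ('o, 'a) cat \<Rightarrow> ('o \<times> 'a) set \<Rightarrow> bool" where
  "intersection_closed U C T \<longleftrightarrow>
     (\<forall>A\<in>Obj C. \<forall>I\<in>U. \<forall>r k. (\<forall>i\<in>I. (A, r i) \<in> T) \<and>
        is_intersection C (prd C A A) I r k \<longrightarrow> (A, k) \<in> T)"

text \<open>A chosen pullback \<open>(m, q)\<close> of \<open>r\<close> along \<open>\<langle>0,1\<rangle>\<close>, with \<open>m : M \<rightarrow> A\<close> and \<open>q : M \<rightarrow> R\<close>.\<close>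

definition norm_pullback :: "('o, 'a) cat \<Rightarrow> 'o \<times> 'a \<Rightarrow> 'a \<times> 'a" where
  "norm_pullback C = (\<lambda>(A, r). SOME (m, q). is_pullback C (zero_one C A) r m q)"

text \<open>In the action on arrows, \<open>h : R \<rightarrow> R'\<close> is the arrow witnessing compatibility of \<open>f\<close> with the
  relations, and \<open>g : M \<rightarrow> M'\<close> is induced by \<open>f \<cdot> m\<close> and \<open>h \<cdot> q\<close>.\<close>

definition normalization ::
    "('o, 'a) cat \<Rightarrow>
     ('o \<times> 'a, ('o \<times> 'a) \<times> ('o \<times> 'a) \<times> 'a, 'a, 'a \<times> 'a \<times> 'a \<times> 'a) func" where
  "normalization C =
     \<lparr>omap = (\<lambda>X. fst (norm_pullback C X)),
      amap = (\<lambda>(X, X', f).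
        let (m, q) = norm_pullback C X;
            (m', q') = norm_pullback C X';
            h = (THE h. h \<in> hom C (Dom C (snd X)) (Dom C (snd X')) \<and>
                   snd X' \<cdot>\<^bsub>C\<^esub> h = prod_map C f f \<cdot>\<^bsub>C\<^esub> snd X);
            g = (THE g. g \<in> hom C (Dom C m) (Dom C m') \<and>
                   m' \<cdot>\<^bsub>C\<^esub> g = f \<cdot>\<^bsub>C\<^esub> m \<and> q' \<cdot>\<^bsub>C\<^esub> g = h \<cdot>\<^bsub>C\<^esub> q)
        in (m, m', g, f))\<rparr>"

definition tau_relations_above :: "('o, 'a) cat \<Rightarrow> ('o \<times> 'a) set \<Rightarrow> 'a \<Rightarrow> 'a set" where
  "tau_relations_above C T m =
     {r. (Cod C m, r) \<in> T \<and> factors_through C (zero_one C (Cod C m) \<cdot>\<^bsub>C\<^esub> m) r}"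

end

theory Submission
  imports Defs
begin

text \<open>An arrow \<open>f : A \<rightarrow> A'\<close> is compatible with \<open>r = \<Inter> S\<^sub>m\<close> and a \<open>\<tau>\<close>-relation \<open>r'\<close> on \<open>A'\<close> iff \<open>r\<close> lies
  below the pullback of \<open>r'\<close> along \<open>f \<times> f\<close>.  That pullback is a \<open>\<tau>\<close>-relation, so this happens iff
  it belongs to \<open>S\<^sub>m\<close>, i.e. iff \<open>(f \<times> f) \<langle>0,1\<rangle> m = \<langle>0,1\<rangle> f m\<close> factors through \<open>r'\<close>, i.e. iff \<open>f m\<close>
  factors through the normalization of \<open>r'\<close>.  As the arrows of both categories are determined by
  their component \<open>f\<close>, this equivalence is the adjunction.  Well-poweredness lets the possibly
  large set \<open>S\<^sub>m\<close> be replaced by a small set of representatives.\<close>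

section \<open>Monomorphisms and factorizations\<close>

context category
begin

lemma homI: "f \<in> Arr C \<Longrightarrow> f \<in> hom C (Dom C f) (Cod C f)"
  by (simp add: hom_def)

lemma hom_Dom: "f \<in> hom C A B \<Longrightarrow> Dom C f = A"
  by (simp add: hom_def)

lemma hom_Cod: "f \<in> hom C A B \<Longrightarrow> Cod C f = B"
  by (simp add: hom_def)

lemma hom_Arr: "f \<in> hom C A B \<Longrightarrow> f \<in> Arr C"
  by (simp add: hom_def)

lemma is_mono_hom: "is_mono C m \<Longrightarrow> m \<in> hom C (Dom C m) (Cod C m)"
  by (simp add: is_mono_def hom_def)

lemma factors_throughI:
  "h \<in> hom C X (Dom C g) \<Longrightarrow> g \<cdot> h = f \<Longrightarrow> f \<in> hom C X A \<Longrightarrow> factors_through C f g"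
  by (auto simp: factors_through_def hom_def)

lemma factors_throughE:
  assumes "factors_through C f g" "f \<in> hom C X A"
  obtains h where "h \<in> hom C X (Dom C g)" "g \<cdot> h = f"
  using assms unfolding factors_through_def hom_Dom[OF assms(2)] by metis

lemma monos_into_hom: "m \<in> monos_into C A \<Longrightarrow> m \<in> hom C (Dom C m) A"
  by (auto simp: monos_into_def is_mono_def hom_def)

lemma is_mono_cancel:
  "is_mono C m \<Longrightarrow> f \<in> hom C X (Dom C m) \<Longrightarrow> g \<in> hom C X (Dom C m) \<Longrightarrow>
    m \<cdot> f = m \<cdot> g \<Longrightarrow> f = g"
  by (simp add: is_mono_def)

lemma is_pullback_hom:
  assumes "is_pullback C f g p q"
  shows "f \<in> hom C (Dom C f) (Cod C g)" and "g \<in> hom C (Dom C g) (Cod C g)"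
    and "p \<in> hom C (Dom C p) (Dom C f)" and "q \<in> hom C (Dom C p) (Dom C g)"
    and "f \<cdot> p = g \<cdot> q"
  using assms by (auto simp: is_pullback_def hom_def)

lemma is_pullback_universal:
  assumes "is_pullback C f g p q" "u \<in> hom C X (Dom C f)" "v \<in> hom C X (Dom C g)"
    and "f \<cdot> u = g \<cdot> v"
  shows "\<exists>!h. h \<in> hom C X (Dom C p) \<and> p \<cdot> h = u \<and> q \<cdot> h = v"
  using assms by (auto simp: is_pullback_def)

lemma hom_Obj:
  assumes "f \<in> hom C A B"
  shows "A \<in> Obj C" and "B \<in> Obj C"
  using assms dom_closed cod_closed by (auto simp: hom_def)

lemma Dom_comp: "f \<in> hom C A B \<Longrightarrow> g \<in> hom C B D \<Longrightarrow> Dom C (g \<cdot> f) = A"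
  by (rule hom_Dom[OF comp_hom])

lemma factors_through_trans:
  assumes "factors_through C f g" "factors_through C g k" "k \<in> Arr C"
  shows "factors_through C f k"
proof -
  obtain a b where a: "a \<in> hom C (Dom C f) (Dom C g)" "f = g \<cdot> a"
    and b: "b \<in> hom C (Dom C g) (Dom C k)" "g = k \<cdot> b"
    using assms(1,2) by (auto simp: factors_through_def)
  have "f = k \<cdot> (b \<cdot> a)"
    using a b comp_assoc[OF a(1) b(1) homI[OF assms(3)]] by simp
  then show ?thesis
    using comp_hom[OF a(1) b(1)] by (auto simp: factors_through_def)
qed

lemma factors_through_comp_left:
  assumes "factors_through C f g" "g \<in> hom C A B" "k \<in> hom C B D"
  shows "factors_through C (k \<cdot> f) (k \<cdot> g)"
proof -
  obtain a where a: "a \<in> hom C (Dom C f) A" "g \<cdot> a = f"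
    using assms(1) hom_Dom[OF assms(2)] by (auto simp: factors_through_def)
  have "f \<in> hom C (Dom C f) B"
    using comp_hom[OF a(1) assms(2)] unfolding a(2) .
  then have "Dom C (k \<cdot> f) = Dom C f" "Dom C (k \<cdot> g) = A"
    using Dom_comp assms(2,3) by blast+
  moreover have "k \<cdot> f = (k \<cdot> g) \<cdot> a"
    using comp_assoc[OF a(1) assms(2,3)] unfolding a(2) by simp
  ultimately show ?thesis
    using a(1) unfolding factors_through_def by metis
qed

text \<open>A factorization of \<open>f \<cdot> u\<close> through \<open>g\<close> is exactly the
  second leg of a cone whose first leg is \<open>u\<close>, and the induced arrow is the
  factorization of \<open>u\<close> through \<open>p\<close>. The lemma serves both for pullbacks
  along \<open>\<langle>0,1\<rangle>\<close> and for pullbacks along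
  \<open>f \<times> f\<close>.\<close>

lemma is_pullback_factors_iff:
  assumes pb: "is_pullback C f g p q" and u: "u \<in> hom C X (Dom C f)"
  shows "factors_through C u p \<longleftrightarrow> factors_through C (f \<cdot> u) g"
proof
  note pbh = is_pullback_hom[OF pb]
  assume "factors_through C u p"
  then obtain h where h: "h \<in> hom C X (Dom C p)" "u = p \<cdot> h"
    using u by (auto simp: factors_through_def hom_Dom)
  have "f \<cdot> u = g \<cdot> (q \<cdot> h)"
    using h comp_assoc[OF h(1) pbh(3,1)] comp_assoc[OF h(1) pbh(4,2)] pbh(5) by simp
  then show "factors_through C (f \<cdot> u) g"
    using comp_hom[OF h(1) pbh(4)] Dom_comp[OF u pbh(1)] by (auto simp: factors_through_def)
next
  note pbh = is_pullback_hom[OF pb]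
  assume "factors_through C (f \<cdot> u) g"
  then obtain v where "v \<in> hom C X (Dom C g)" "f \<cdot> u = g \<cdot> v"
    unfolding factors_through_def Dom_comp[OF u pbh(1)] by blast
  then obtain h where "h \<in> hom C X (Dom C p)" "p \<cdot> h = u"
    using is_pullback_universal[OF pb u] by blast
  then show "factors_through C u p"
    unfolding factors_through_def hom_Dom[OF u] by blast
qed

text \<open>If \<open>p \<cdot> a = p \<cdot> b\<close>, then \<open>a\<close> and \<open>b\<close>
  also agree after \<open>g \<cdot> q = f \<cdot> p\<close>, hence after \<open>q\<close> because
  \<open>g\<close> is mono; uniqueness in the universal property gives \<open>a = b\<close>.\<close>

lemma is_pullback_mono:
  assumes pb: "is_pullback C f g p q" and g: "is_mono C g"
  shows "is_mono C p"
  unfolding is_mono_def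
proof (intro conjI allI ballI impI)
  note pbh = is_pullback_hom[OF pb]
  show "p \<in> Arr C"
    using pbh(3) hom_Arr by blast
  fix X a b
  assume a: "a \<in> hom C X (Dom C p)" and b: "b \<in> hom C X (Dom C p)" and eq: "p \<cdot> a = p \<cdot> b"
  have "g \<cdot> (q \<cdot> a) = f \<cdot> (p \<cdot> a)" "g \<cdot> (q \<cdot> b) = f \<cdot> (p \<cdot> b)"
    using comp_assoc[OF a pbh(3,1)] comp_assoc[OF a pbh(4,2)]
      comp_assoc[OF b pbh(3,1)] comp_assoc[OF b pbh(4,2)] pbh(5) by simp_all
  then have "g \<cdot> (q \<cdot> a) = g \<cdot> (q \<cdot> b)" and com: "f \<cdot> (p \<cdot> a) = g \<cdot> (q \<cdot> a)"
    using eq by simp_all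
  then have "q \<cdot> a = q \<cdot> b"
    using is_mono_cancel[OF g] comp_hom[OF a pbh(4)] comp_hom[OF b pbh(4)] by blast
  then show "a = b"
    using is_pullback_universal[OF pb comp_hom[OF a pbh(3)] comp_hom[OF a pbh(4)] com] a b eq
    by auto
qed

section \<open>Intersections of subobjects\<close>

lemma is_wide_pullback_mono:
  assumes k: "is_wide_pullback C A I m k p" and m: "m ` I \<subseteq> monos_into C A"
  shows "is_mono C k"
  unfolding is_mono_def
proof (intro conjI allI ballI impI)
  have kh: "k \<in> hom C (Dom C k) A"
    and p: "\<And>i. i \<in> I \<Longrightarrow> p i \<in> hom C (Dom C k) (Dom C (m i)) \<and> m i \<cdot> p i = k"
    using k by (auto simp: is_wide_pullback_def)
  show "k \<in> Arr C"
    using kh hom_Arr by blast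
  fix X a b
  assume a: "a \<in> hom C X (Dom C k)" and b: "b \<in> hom C X (Dom C k)" and eq: "k \<cdot> a = k \<cdot> b"
  have *: "p i \<cdot> c \<in> hom C X (Dom C (m i)) \<and> m i \<cdot> (p i \<cdot> c) = k \<cdot> c"
    if "i \<in> I" "c \<in> hom C X (Dom C k)" for i c
  proof -
    have "m i \<in> hom C (Dom C (m i)) A"
      using m that(1) monos_into_hom by blast
    then show ?thesis
      using p[OF that(1)] comp_hom[OF that(2), of "p i" "Dom C (m i)"]
        comp_assoc[OF that(2), of "p i" "Dom C (m i)" "m i" A]
      by auto
  qed
  have "p i \<cdot> a = p i \<cdot> b" if i: "i \<in> I" for i
  proof (rule is_mono_cancel)
    show "is_mono C (m i)" using m i by (auto simp: monos_into_def)
    show "p i \<cdot> a \<in> hom C X (Dom C (m i))" "p i \<cdot> b \<in> hom C X (Dom C (m i))"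
      using *[OF i a] *[OF i b] by blast+
    show "m i \<cdot> (p i \<cdot> a) = m i \<cdot> (p i \<cdot> b)"
      using *[OF i a] *[OF i b] eq by metis
  qed
  \<comment> \<open>Both \<open>a\<close> and \<open>b\<close> mediate for this one cone. The
    equation on \<open>k\<close> itself is part of the uniqueness clause, so the argument also
    covers the empty family, which has no projections.\<close>
  moreover have "\<exists>!h. h \<in> hom C X (Dom C k) \<and> k \<cdot> h = k \<cdot> a \<and> (\<forall>i\<in>I. p i \<cdot> h = p i \<cdot> a)"
  proof -
    have "k \<cdot> a \<in> hom C X A \<and>
        (\<forall>i\<in>I. p i \<cdot> a \<in> hom C X (Dom C (m i)) \<and> m i \<cdot> (p i \<cdot> a) = k \<cdot> a)"
      using *[OF _ a] comp_hom[OF a kh] by blast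
    with k[unfolded is_wide_pullback_def, THEN conjunct2, THEN conjunct2, rule_format,
        of "k \<cdot> a" X "\<lambda>i. p i \<cdot> a"]
    show ?thesis by blast
  qed
  ultimately show "a = b"
    using a b eq by metis
qed

lemma is_intersection_monos_into:
  assumes "is_intersection C A I m k"
  shows "k \<in> monos_into C A"
proof -
  obtain p where m: "m ` I \<subseteq> monos_into C A" and p: "is_wide_pullback C A I m k p"
    using assms unfolding is_intersection_def by blast
  have "k \<in> hom C (Dom C k) A"
    using p unfolding is_wide_pullback_def by blast
  then show ?thesis
    using is_wide_pullback_mono[OF p m] hom_Cod by (simp add: monos_into_def)
qed

text \<open>A family of factorizations of \<open>f\<close> through the \<open>m i\<close> is
  precisely a cone over the family with apex \<open>X\<close>. Thus an intersection is a greatest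
  lower bound for factorization, tested against arbitrary arrows.\<close>

lemma is_intersection_factors_iff:
  assumes k: "is_intersection C A I m k" and f: "f \<in> hom C X A"
  shows "factors_through C f k \<longleftrightarrow> (\<forall>i\<in>I. factors_through C f (m i))"
proof
  have m: "m i \<in> hom C (Dom C (m i)) A" if "i \<in> I" for i
    using k that monos_into_hom unfolding is_intersection_def by blast
  obtain p where p: "is_wide_pullback C A I m k p"
    using k by (auto simp: is_intersection_def)
  have kh: "k \<in> hom C (Dom C k) A"
    using p unfolding is_wide_pullback_def by blast
  { assume *: "factors_through C f k"
    show "\<forall>i\<in>I. factors_through C f (m i)"
    proof
      fix i assume i: "i \<in> I"
      have "factors_through C k (m i)"
        unfolding factors_through_def
        by (rule bexI[of _ "p i"]) (use p i in \<open>auto simp: is_wide_pullback_def\<close>)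
      then show "factors_through C f (m i)"
        using factors_through_trans[OF * _ hom_Arr[OF m[OF i]]] by blast
    qed }
  { assume "\<forall>i\<in>I. factors_through C f (m i)"
    then obtain q where "\<forall>i\<in>I. q i \<in> hom C X (Dom C (m i)) \<and> m i \<cdot> q i = f"
      unfolding factors_through_def hom_Dom[OF f] by metis
    then have "\<exists>h. h \<in> hom C X (Dom C k) \<and> k \<cdot> h = f"
      using p[unfolded is_wide_pullback_def, THEN conjunct2, THEN conjunct2, rule_format,
          of f X q] f by blast
    then show "factors_through C f k"
      unfolding factors_through_def hom_Dom[OF f] by blast }
qed

text \<open>For monomorphisms the existence of factorizations is enough: compatibility with the
  projections follows by cancelling \<open>m i\<close>, and uniqueness by cancelling
  \<open>k\<close>.\<close>

lemma is_intersectionI: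
  assumes m: "m ` I \<subseteq> monos_into C A" and k: "k \<in> monos_into C A"
    and le: "\<And>i. i \<in> I \<Longrightarrow> factors_through C k (m i)"
    and greatest: "\<And>X f. f \<in> hom C X A \<Longrightarrow> (\<And>i. i \<in> I \<Longrightarrow> factors_through C f (m i)) \<Longrightarrow>
      factors_through C f k"
  shows "is_intersection C A I m k"
proof -
  have mono: "is_mono C (m i)" and mh: "m i \<in> hom C (Dom C (m i)) A" if "i \<in> I" for i
    using m that monos_into_hom by (auto simp: monos_into_def)
  have kmono: "is_mono C k" and kh: "k \<in> hom C (Dom C k) A"
    using k monos_into_hom by (auto simp: monos_into_def)
  obtain p where p: "\<And>i. i \<in> I \<Longrightarrow> p i \<in> hom C (Dom C k) (Dom C (m i)) \<and> m i \<cdot> p i = k"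
    using le unfolding factors_through_def by metis
  have "is_wide_pullback C A I m k p"
    unfolding is_wide_pullback_def
  proof (intro conjI allI impI)
    show "k \<in> hom C (Dom C k) A" by (rule kh)
    show "\<forall>i\<in>I. p i \<in> hom C (Dom C k) (Dom C (m i)) \<and> m i \<cdot> p i = k"
      using p by blast
    fix X f q
    assume *: "f \<in> hom C X A \<and> (\<forall>i\<in>I. q i \<in> hom C X (Dom C (m i)) \<and> m i \<cdot> q i = f)"
    then have f: "f \<in> hom C X A" by blast
    have "factors_through C f k"
    proof (rule greatest[OF f])
      fix i assume "i \<in> I"
      then show "factors_through C f (m i)"
        using factors_throughI[of "q i" X "m i" f A] * by blast
    qed
    then obtain h where h: "h \<in> hom C X (Dom C k)" "k \<cdot> h = f"
      using f by (rule factors_throughE)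
    have "p i \<cdot> h = q i" if i: "i \<in> I" for i
    proof (rule is_mono_cancel[OF mono[OF i]])
      have ph: "p i \<in> hom C (Dom C k) (Dom C (m i))" using p[OF i] by blast
      show "p i \<cdot> h \<in> hom C X (Dom C (m i))" using comp_hom[OF h(1) ph] .
      show "q i \<in> hom C X (Dom C (m i))" using * i by blast
      show "m i \<cdot> (p i \<cdot> h) = m i \<cdot> q i"
        using comp_assoc[OF h(1) ph mh[OF i]] p[OF i] * i h(2) by metis
    qed
    with h show "\<exists>!h. h \<in> hom C X (Dom C k) \<and> k \<cdot> h = f \<and> (\<forall>i\<in>I. p i \<cdot> h = q i)"
      using is_mono_cancel[OF kmono] by blast
  qed
  then show ?thesis
    using m by (auto simp: is_intersection_def)
qed

section \<open>Reduction of large intersections to small ones\<close>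

lemma small_representatives:
  assumes U: "smallness U" "well_powered U C" and A: "A \<in> Obj C" and S: "S \<subseteq> monos_into C A"
  obtains J m where "J \<in> U" "m ` J \<subseteq> S"
    "\<And>s. s \<in> S \<Longrightarrow> \<exists>j\<in>J. factors_through C s (m j) \<and> factors_through C (m j) s"
proof -
  define E where "E = {(m, n). m \<in> monos_into C A \<and> n \<in> monos_into C A \<and>
     factors_through C m n \<and> factors_through C n m}"
  obtain I s where I: "I \<in> U" and s: "bij_betw s I (monos_into C A // E)"
    using U(2) A unfolding well_powered_def subobjects_def E_def by blast
  \<comment> \<open>\<open>I\<close> indexes all subobjects of \<open>A\<close>; \<open>J\<close>
    keeps the classes that meet \<open>S\<close>, and is small as a subset of
    \<open>I\<close>.\<close>
  define J where "J = {i \<in> I. s i \<inter> S \<noteq> {}}"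
  \<comment> \<open>The representative is taken from \<open>S\<close> itself, not just from the
    class, so that it inherits membership in \<open>T\<close> when this is applied to
    \<tau>-relations.\<close>
  define m where "m = (\<lambda>i. SOME x. x \<in> s i \<inter> S)"
  have m: "m j \<in> s j \<inter> S" if "j \<in> J" for j
    using that someI_ex[of "\<lambda>x. x \<in> s j \<inter> S"] unfolding J_def m_def by blast
  show thesis
  proof (rule that)
    show "J \<in> U"
      using U(1) I unfolding smallness_def J_def by (metis (no_types, lifting) mem_Collect_eq subsetI)
    show "m ` J \<subseteq> S" using m by blast
    fix x assume x: "x \<in> S"
    then have xA: "x \<in> monos_into C A" using S by blast
    then have "E `` {x} \<in> s ` I"
      using s by (auto simp: bij_betw_def intro: quotientI)
    then obtain i where i: "i \<in> I" "s i = E `` {x}" by auto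
    have "Ident C (Dom C x) \<in> hom C (Dom C x) (Dom C x)" "x \<cdot> Ident C (Dom C x) = x"
      using monos_into_hom[OF xA, THEN ident_right] ident_hom[OF hom_Obj(1)[OF monos_into_hom[OF xA]]]
      by auto
    \<comment> \<open>Reflexivity puts \<open>x\<close> into its own class, so that class meets
      \<open>S\<close>; the chosen \<open>m i\<close> lies in the same class and is therefore
      equivalent to \<open>x\<close>.\<close>
    then have "(x, x) \<in> E"
      using xA unfolding E_def factors_through_def by (auto intro!: bexI[of _ "Ident C (Dom C x)"])
    then have "i \<in> J" using i x unfolding J_def by auto
    then show "\<exists>j\<in>J. factors_through C x (m j) \<and> factors_through C (m j) x"
      using m[of i] i unfolding E_def by auto
  qed
qed

text \<open>Both \<open>has_intersections\<close> and \<open>intersection_closed\<close> speak of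
  index sets in \<open>U\<close>, whereas \<open>S\<close> may be large. The intersection of a small
  family of representatives is also the intersection of all of \<open>S\<close>, because each member
  of \<open>S\<close> and its representative factor through each other.\<close>

lemma ex_intersection_closed:
  assumes U: "smallness U" "well_powered U C" "has_intersections U C" and T: "intersection_closed U C T"
    and A: "A \<in> Obj C" "prd C A A \<in> Obj C"
    and S: "S \<subseteq> monos_into C (prd C A A)" "\<And>s. s \<in> S \<Longrightarrow> (A, s) \<in> T"
  shows "\<exists>k. is_intersection C (prd C A A) S (\<lambda>s. s) k \<and> (A, k) \<in> T"
proof -
  obtain J m where J: "J \<in> U" and m: "m ` J \<subseteq> S"
    and rep: "\<And>s. s \<in> S \<Longrightarrow> \<exists>j\<in>J. factors_through C s (m j) \<and> factors_through C (m j) s"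
    using small_representatives[OF U(1,2) A(2) S(1)] by metis
  obtain k where k: "is_intersection C (prd C A A) J m k"
    using U(3) A(2) J m S(1) unfolding has_intersections_def by (meson order_trans)
  have kT: "(A, k) \<in> T"
    using T[unfolded intersection_closed_def, rule_format, OF A(1) J, of m k] m S(2) k by blast
  have km: "k \<in> monos_into C (prd C A A)" and kh: "k \<in> hom C (Dom C k) (prd C A A)"
    using is_intersection_monos_into[OF k] monos_into_hom by auto
  have "factors_through C k k"
    using kh ident_hom[OF hom_Obj(1)[OF kh]] ident_right[OF kh] unfolding factors_through_def by metis
  \<comment> \<open>Testing the greatest lower bound property at \<open>k\<close> itself shows that
    \<open>k\<close> is a lower bound.\<close>
  then have kj: "factors_through C k (m j)" if "j \<in> J" for j
    using is_intersection_factors_iff[OF k kh] that by blast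
  have arr: "s \<in> Arr C" if "s \<in> S" for s
    using that S(1) monos_into_hom hom_Arr by blast
  have "is_intersection C (prd C A A) S (\<lambda>s. s) k"
  proof (rule is_intersectionI)
    show "(\<lambda>s. s) ` S \<subseteq> monos_into C (prd C A A)" using S(1) by simp
    show "k \<in> monos_into C (prd C A A)" by (rule km)
    show "factors_through C k s" if "s \<in> S" for s
      using rep[OF that] factors_through_trans[OF kj _ arr[OF that]] by blast
    show "factors_through C f k" if f: "f \<in> hom C X (prd C A A)"
      and le: "\<And>s. s \<in> S \<Longrightarrow> factors_through C f s" for X f
      unfolding is_intersection_factors_iff[OF k f] using le m by blast
  qed
  with kT show ?thesis by blast
qed

end

section \<open>Pullbacks and products\<close>

text \<open>The shape \<open>0 \<rightarrow> 2 \<leftarrow> 1\<close>: the arrow \<open>j \<le> 2\<close> is the identity of \<open>j\<close>, and \<open>3\<close>, \<open>4\<close> are the arrows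
  out of \<open>0\<close>, \<open>1\<close>.  With this numbering every composite is the larger of the two arrows.\<close>

definition cospan :: "(nat, nat) cat" where
  "cospan = \<lparr>Obj = {0, 1, 2}, Arr = {0, 1, 2, 3, 4}, Dom = (\<lambda>a. if a < 3 then a else a - 3),
     Cod = (\<lambda>a. min a 2), Ident = (\<lambda>a. a), Comp = max\<rparr>"

definition cospan_diagram :: "('o, 'a) cat \<Rightarrow> 'a \<Rightarrow> 'a \<Rightarrow> (nat, nat, 'o, 'a) func" where
  "cospan_diagram C f g =
     (let ob = (\<lambda>j. if j = 0 then Dom C f else if j = 1 then Dom C g else Cod C f) in
      \<lparr>omap = ob, amap = (\<lambda>a. if a = 3 then f else if a = 4 then g else Ident C (ob a))\<rparr>)"

lemma category_cospan: "category cospan"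
  by unfold_locales (auto simp: cospan_def hom_def)

context category
begin

lemma is_functor_cospan_diagram:
  assumes "f \<in> Arr C" "g \<in> Arr C" "Cod C f = Cod C g"
  shows "is_functor cospan C (cospan_diagram C f g)"
proof -
  have f: "f \<in> hom C (Dom C f) (Cod C g)" and g: "g \<in> hom C (Dom C g) (Cod C g)"
    using assms by (auto simp: hom_def)
  have "Dom C f \<in> Obj C" "Dom C g \<in> Obj C" "Cod C g \<in> Obj C"
    using assms dom_closed cod_closed by auto
  moreover note ident_left[OF f] ident_left[OF g] ident_right[OF f] ident_right[OF g]
  moreover have "Ident C X \<cdot> Ident C X = Ident C X" if "X \<in> Obj C" for X
    using ident_left ident_hom that by blast
  ultimately show ?thesis
    unfolding is_functor_def using category_cospan category_axioms f g assms ident_hom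
    by (auto simp: cospan_def cospan_diagram_def hom_def)
qed

text \<open>The leg of a cone at the vertex \<open>2\<close> is forced to be the common composite,
  so cones over the cospan diagram are commuting squares and a limit cone is a pullback
  square.\<close>

lemma ex_pullback:
  assumes fc: "finitely_complete C" and f: "f \<in> hom C A X" and g: "g \<in> hom C B X"
  shows "\<exists>p q. is_pullback C f g p q"
proof -
  have fg: "f \<in> Arr C" "g \<in> Arr C" "Cod C f = Cod C g"
    using f g by (auto simp: hom_def)
  have "finite (Obj cospan)" "finite (Arr cospan)"
    by (auto simp: cospan_def)
  then obtain L \<pi> where L: "is_limit cospan C (cospan_diagram C f g) L \<pi>"
    using fc is_functor_cospan_diagram[OF fg] unfolding finitely_complete_def by blast
  \<comment> \<open>The identities of the shape impose no condition; the arrows \<open>3\<close> and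
    \<open>4\<close> express the leg at \<open>2\<close> through \<open>f\<close> and through
    \<open>g\<close>.\<close>
  have cone_iff: "is_cone cospan C (cospan_diagram C f g) Y \<xi> \<longleftrightarrow>
      \<xi> 0 \<in> hom C Y A \<and> \<xi> 1 \<in> hom C Y B \<and> \<xi> 2 = f \<cdot> \<xi> 0 \<and> f \<cdot> \<xi> 0 = g \<cdot> \<xi> 1" for Y \<xi>
  proof -
    have "f \<cdot> \<xi> 0 \<in> hom C Y X" if "\<xi> 0 \<in> hom C Y A" using comp_hom[OF that f] .
    then show ?thesis
      using f g ident_left hom_Obj(1)[of "\<xi> 0" Y A]
      by (auto simp: is_cone_def cospan_def cospan_diagram_def hom_Dom[OF f] hom_Dom[OF g] hom_Cod[OF f])
  qed
  have \<pi>: "\<pi> 0 \<in> hom C L A" "\<pi> 1 \<in> hom C L B" "\<pi> 2 = f \<cdot> \<pi> 0" "f \<cdot> \<pi> 0 = g \<cdot> \<pi> 1"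
    using L unfolding is_limit_def cone_iff by auto
  have "\<exists>!h. h \<in> hom C Y L \<and> \<pi> 0 \<cdot> h = u \<and> \<pi> 1 \<cdot> h = v"
    if u: "u \<in> hom C Y A" and v: "v \<in> hom C Y B" and uv: "f \<cdot> u = g \<cdot> v" for Y u v
  proof -
    define \<xi> where "\<xi> = (\<lambda>j::nat. if j = 0 then u else if j = 1 then v else f \<cdot> u)"
    have "is_cone cospan C (cospan_diagram C f g) Y \<xi>"
      unfolding cone_iff using u v uv by (simp add: \<xi>_def)
    then have "\<exists>!h. h \<in> hom C Y L \<and> (\<forall>j\<in>Obj cospan. \<pi> j \<cdot> h = \<xi> j)"
      using L unfolding is_limit_def by blast
    \<comment> \<open>The condition at the vertex \<open>2\<close> is a consequence of the one at
      \<open>0\<close>.\<close>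
    moreover have "(\<forall>j\<in>Obj cospan. \<pi> j \<cdot> h = \<xi> j) \<longleftrightarrow> \<pi> 0 \<cdot> h = u \<and> \<pi> 1 \<cdot> h = v"
      if "h \<in> hom C Y L" for h
      using comp_assoc[OF that \<pi>(1) f] \<pi>(3) by (auto simp: cospan_def \<xi>_def)
    ultimately show ?thesis by (metis (no_types, lifting))
  qed
  then have "is_pullback C f g (\<pi> 0) (\<pi> 1)"
    using \<pi> fg f g by (auto simp: is_pullback_def hom_Dom)
  then show ?thesis by blast
qed

end

section \<open>Products in a pointed, finitely complete category\<close>

locale pointed_complete_category = category C for C :: "('o, 'a) cat" (structure) +
  assumes pointed: "pointed C" and finitely_complete: "finitely_complete C"
begin

lemma zero_objectE:
  assumes "zero_object C Z" "X \<in> Obj C"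
  obtains u v where "u \<in> hom C X Z" "v \<in> hom C Z X"
  using assms unfolding zero_object_def by metis

lemma zero_object_terminal:
  "zero_object C Z \<Longrightarrow> f \<in> hom C X Z \<Longrightarrow> g \<in> hom C X Z \<Longrightarrow> f = g"
  using hom_Obj(1)[of f X Z] unfolding zero_object_def by metis

lemma zero_object_initial:
  "zero_object C Z \<Longrightarrow> f \<in> hom C Z X \<Longrightarrow> g \<in> hom C Z X \<Longrightarrow> f = g"
  using hom_Obj(2)[of f Z X] unfolding zero_object_def by metis

text \<open>A product is a pullback over the zero object: arrows into it are unique, so every pair
  of arrows with a common domain forms a commuting square.\<close>

lemma ex_product:
  assumes A: "A \<in> Obj C" and B: "B \<in> Obj C"
  shows "\<exists>P p q. is_product C A B P p q"
proof -
  obtain Z where Z: "zero_object C Z"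
    using pointed by (auto simp: pointed_def)
  obtain f g where f: "f \<in> hom C A Z" and g: "g \<in> hom C B Z"
    using zero_objectE[OF Z A] zero_objectE[OF Z B] by metis
  obtain p q where pq: "is_pullback C f g p q"
    using ex_pullback[OF finitely_complete f g] by blast
  note pbh = is_pullback_hom[OF pq, unfolded hom_Dom[OF f] hom_Dom[OF g]]
  have "is_product C A B (Dom C p) p q"
    unfolding is_product_def
  proof (intro conjI allI ballI)
    fix X u v assume u: "u \<in> hom C X A" and v: "v \<in> hom C X B"
    have "f \<cdot> u = g \<cdot> v"
      using zero_object_terminal[OF Z comp_hom[OF u f] comp_hom[OF v g]] .
    then show "\<exists>!h. h \<in> hom C X (Dom C p) \<and> p \<cdot> h = u \<and> q \<cdot> h = v"
      using is_pullback_universal[OF pq] u v f g by (simp add: hom_Dom)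
  qed (use pbh in auto)
  then show ?thesis by blast
qed

lemma is_product_prd:
  assumes "A \<in> Obj C" "B \<in> Obj C"
  shows "is_product C A B (prd C A B) (pr1 C A B) (pr2 C A B)"
proof -
  have "\<exists>x. case x of (P, p, q) \<Rightarrow> is_product C A B P p q"
    using ex_product[OF assms] by auto
  then have "case product_cone C A B of (P, p, q) \<Rightarrow> is_product C A B P p q"
    unfolding product_cone_def by (rule someI_ex)
  then show ?thesis
    by (simp add: prd_def pr1_def pr2_def split_beta)
qed

lemma pr_hom:
  assumes "A \<in> Obj C" "B \<in> Obj C"
  shows "pr1 C A B \<in> hom C (prd C A B) A" and "pr2 C A B \<in> hom C (prd C A B) B"
  using is_product_prd[OF assms] by (auto simp: is_product_def)

lemma prd_Obj: "A \<in> Obj C \<Longrightarrow> B \<in> Obj C \<Longrightarrow> prd C A B \<in> Obj C"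
  by (rule hom_Obj(1)[OF pr_hom(1)])

lemma pairing:
  assumes f: "f \<in> hom C X A" and g: "g \<in> hom C X B"
  shows pairing_hom: "pairing C f g \<in> hom C X (prd C A B)"
    and pr1_pairing: "pr1 C A B \<cdot> pairing C f g = f"
    and pr2_pairing: "pr2 C A B \<cdot> pairing C f g = g"
proof -
  have "\<exists>!h. h \<in> hom C X (prd C A B) \<and> pr1 C A B \<cdot> h = f \<and> pr2 C A B \<cdot> h = g"
    using is_product_prd[OF hom_Obj(2)[OF f] hom_Obj(2)[OF g]] f g by (auto simp: is_product_def)
  from theI'[OF this] show "pairing C f g \<in> hom C X (prd C A B)"
    "pr1 C A B \<cdot> pairing C f g = f" "pr2 C A B \<cdot> pairing C f g = g"
    by (auto simp: pairing_def hom_Dom[OF f] hom_Cod[OF f] hom_Cod[OF g])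
qed

lemma prd_eqI:
  assumes A: "A \<in> Obj C" "B \<in> Obj C" and h: "h \<in> hom C X (prd C A B)" and k: "k \<in> hom C X (prd C A B)"
    and "pr1 C A B \<cdot> h = pr1 C A B \<cdot> k" "pr2 C A B \<cdot> h = pr2 C A B \<cdot> k"
  shows "h = k"
proof -
  have "\<exists>!j. j \<in> hom C X (prd C A B) \<and> pr1 C A B \<cdot> j = pr1 C A B \<cdot> k \<and> pr2 C A B \<cdot> j = pr2 C A B \<cdot> k"
    using is_product_prd[OF A] comp_hom[OF k pr_hom(1)[OF A]] comp_hom[OF k pr_hom(2)[OF A]]
    by (auto simp: is_product_def)
  then show ?thesis using assms by blast
qed

lemma pairing_comp:
  assumes f: "f \<in> hom C X A" and g: "g \<in> hom C X B" and e: "e \<in> hom C Y X"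
  shows "pairing C f g \<cdot> e = pairing C (f \<cdot> e) (g \<cdot> e)"
proof (rule prd_eqI)
  note fg = pairing_hom[OF f g]
  note fe = comp_hom[OF e f] and ge = comp_hom[OF e g]
  show AB: "A \<in> Obj C" "B \<in> Obj C" using f g hom_Obj by auto
  show "pairing C f g \<cdot> e \<in> hom C Y (prd C A B)" using comp_hom[OF e fg] .
  show "pairing C (f \<cdot> e) (g \<cdot> e) \<in> hom C Y (prd C A B)" using pairing_hom[OF fe ge] .
  show "pr1 C A B \<cdot> (pairing C f g \<cdot> e) = pr1 C A B \<cdot> pairing C (f \<cdot> e) (g \<cdot> e)"
    "pr2 C A B \<cdot> (pairing C f g \<cdot> e) = pr2 C A B \<cdot> pairing C (f \<cdot> e) (g \<cdot> e)"
    using comp_assoc[OF e fg pr_hom(1)[OF AB]] comp_assoc[OF e fg pr_hom(2)[OF AB]]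
      pairing(2,3)[OF f g] pairing(2,3)[OF fe ge] by simp_all
qed

lemma prod_map_hom:
  assumes f: "f \<in> hom C A A'" and g: "g \<in> hom C B B'"
  shows "prod_map C f g \<in> hom C (prd C A B) (prd C A' B')"
  unfolding prod_map_def hom_Dom[OF f] hom_Dom[OF g]
  by (rule pairing_hom[OF comp_hom[OF pr_hom(1) f] comp_hom[OF pr_hom(2) g]])
    (use hom_Obj[OF f] hom_Obj[OF g] in auto)

lemma prod_map_pairing:
  assumes f: "f \<in> hom C A A'" and g: "g \<in> hom C B B'" and a: "a \<in> hom C X A" and b: "b \<in> hom C X B"
  shows "prod_map C f g \<cdot> pairing C a b = pairing C (f \<cdot> a) (g \<cdot> b)"
proof -
  note pr = pr_hom[OF hom_Obj(1)[OF f] hom_Obj(1)[OF g]]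
  note ab = pairing[OF a b]
  show ?thesis
    unfolding prod_map_def hom_Dom[OF f] hom_Dom[OF g]
    using pairing_comp[OF comp_hom[OF pr(1) f] comp_hom[OF pr(2) g] ab(1)]
      comp_assoc[OF ab(1) pr(1) f] comp_assoc[OF ab(1) pr(2) g] ab(2,3) by simp
qed

lemma prod_map_comp:
  assumes f: "f \<in> hom C A A'" and g: "g \<in> hom C B B'" and f': "f' \<in> hom C A' A''" and g': "g' \<in> hom C B' B''"
  shows "prod_map C (f' \<cdot> f) (g' \<cdot> g) = prod_map C f' g' \<cdot> prod_map C f g"
proof -
  note pr = pr_hom[OF hom_Obj(1)[OF f] hom_Obj(1)[OF g]]
  show ?thesis
    using prod_map_pairing[OF f' g' comp_hom[OF pr(1) f] comp_hom[OF pr(2) g]]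
      comp_assoc[OF pr(1) f f'] comp_assoc[OF pr(2) g g']
    by (simp add: prod_map_def hom_Dom[OF f] hom_Dom[OF g]
        Dom_comp[OF f f'] Dom_comp[OF g g'])
qed

lemma prod_map_ident:
  assumes "A \<in> Obj C" "B \<in> Obj C"
  shows "prod_map C (Ident C A) (Ident C B) = Ident C (prd C A B)"
proof (rule prd_eqI[OF assms])
  note i = ident_hom[OF assms(1)] ident_hom[OF assms(2)]
  note pr = pr_hom[OF assms]
  note ip = comp_hom[OF pr(1) i(1)] comp_hom[OF pr(2) i(2)]
  show "prod_map C (Ident C A) (Ident C B) \<in> hom C (prd C A B) (prd C A B)"
    using prod_map_hom[OF i] .
  show "Ident C (prd C A B) \<in> hom C (prd C A B) (prd C A B)"
    using ident_hom[OF prd_Obj[OF assms]] .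
  show "pr1 C A B \<cdot> prod_map C (Ident C A) (Ident C B) = pr1 C A B \<cdot> Ident C (prd C A B)"
    "pr2 C A B \<cdot> prod_map C (Ident C A) (Ident C B) = pr2 C A B \<cdot> Ident C (prd C A B)"
    using pairing(2,3)[OF ip] ident_left[OF pr(1)] ident_left[OF pr(2)]
      ident_right[OF pr(1)] ident_right[OF pr(2)]
    by (simp_all add: prod_map_def hom_Dom[OF i(1)] hom_Dom[OF i(2)])
qed

section \<open>Zero morphisms\<close>

text \<open>The description in \<open>zero_arr\<close> ranges over all zero objects, so independence
  of the one used is required. An arrow \<open>t\<close> between the two zero objects carries one
  factorization to the other: \<open>b = v \<cdot> t\<close> by initiality and
  \<open>t \<cdot> a = u\<close> by terminality.\<close>

lemma zero_arr_eq:
  assumes Z: "zero_object C Z" and u: "u \<in> hom C A Z" and v: "v \<in> hom C Z B"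
  shows "zero_arr C A B = v \<cdot> u"
  unfolding zero_arr_def
proof (rule the_equality)
  show "\<exists>Z. zero_object C Z \<and> (\<exists>a\<in>hom C A Z. \<exists>b\<in>hom C Z B. v \<cdot> u = b \<cdot> a)"
    using assms by blast
  fix f assume "\<exists>Z. zero_object C Z \<and> (\<exists>a\<in>hom C A Z. \<exists>b\<in>hom C Z B. f = b \<cdot> a)"
  then obtain Z' a b where Z': "zero_object C Z'" and a: "a \<in> hom C A Z'" and b: "b \<in> hom C Z' B"
    and f: "f = b \<cdot> a" by blast
  obtain t where t: "t \<in> hom C Z' Z"
    using zero_objectE[OF Z] Z' unfolding zero_object_def by metis
  have "b = v \<cdot> t"
    using zero_object_initial[OF Z' b comp_hom[OF t v]] .
  moreover have "t \<cdot> a = u"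
    using zero_object_terminal[OF Z comp_hom[OF a t] u] .
  ultimately show "f = v \<cdot> u"
    using comp_assoc[OF a t v] f by simp
qed

lemma zero_arr_factor:
  assumes "A \<in> Obj C" "B \<in> Obj C"
  obtains Z u v where "zero_object C Z" "u \<in> hom C A Z" "v \<in> hom C Z B" "zero_arr C A B = v \<cdot> u"
proof -
  obtain Z where Z: "zero_object C Z" using pointed by (auto simp: pointed_def)
  then obtain u v where "u \<in> hom C A Z" "v \<in> hom C Z B"
    using zero_objectE[OF Z assms(1)] zero_objectE[OF Z assms(2)] by metis
  with that[OF Z] zero_arr_eq[OF Z] show thesis by blast
qed

lemma zero_arr_hom: "A \<in> Obj C \<Longrightarrow> B \<in> Obj C \<Longrightarrow> zero_arr C A B \<in> hom C A B"
  by (metis zero_arr_factor comp_hom)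

text \<open>A factorization through a zero object remains one after composition with
  \<open>f\<close>, and \<open>zero_arr_eq\<close> recognizes the result.\<close>

lemma comp_zero_arr:
  assumes f: "f \<in> hom C B D" and A: "A \<in> Obj C"
  shows "f \<cdot> zero_arr C A B = zero_arr C A D"
proof -
  obtain Z u v where *: "zero_object C Z" "u \<in> hom C A Z" "v \<in> hom C Z B" "zero_arr C A B = v \<cdot> u"
    using zero_arr_factor[OF A hom_Obj(1)[OF f]] .
  show ?thesis
    using zero_arr_eq[OF *(1,2) comp_hom[OF *(3) f]] comp_assoc[OF *(2,3) f] *(4) by simp
qed

lemma zero_arr_comp:
  assumes f: "f \<in> hom C A B" and D: "D \<in> Obj C"
  shows "zero_arr C B D \<cdot> f = zero_arr C A D"
proof -
  obtain Z u v where *: "zero_object C Z" "u \<in> hom C B Z" "v \<in> hom C Z D" "zero_arr C B D = v \<cdot> u"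
    using zero_arr_factor[OF hom_Obj(2)[OF f] D] .
  show ?thesis
    using zero_arr_eq[OF *(1) comp_hom[OF f *(2)] *(3)] comp_assoc[OF f *(2,3)] *(4) by simp
qed

lemma zero_one_hom: "A \<in> Obj C \<Longrightarrow> zero_one C A \<in> hom C A (prd C A A)"
  unfolding zero_one_def by (intro pairing_hom zero_arr_hom ident_hom)

text \<open>Both sides are the pairing of a zero arrow with \<open>f\<close>. This naturality is
  what lets an arrow compatible with relations restrict to their normalizations.\<close>

lemma zero_one_natural:
  assumes f: "f \<in> hom C A A'"
  shows "prod_map C f f \<cdot> zero_one C A = zero_one C A' \<cdot> f"
proof -
  note A = hom_Obj(1)[OF f] and A' = hom_Obj(2)[OF f]
  show ?thesis
    unfolding zero_one_def
    using prod_map_pairing[OF f f zero_arr_hom[OF A A] ident_hom[OF A]]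
      pairing_comp[OF zero_arr_hom[OF A' A'] ident_hom[OF A'] f]
      comp_zero_arr[OF f A] zero_arr_comp[OF f A'] ident_left[OF f] ident_right[OF f] by simp
qed

end

section \<open>The categories of monomorphisms and of relations\<close>

text \<open>The arrow of \<open>mono_cat C\<close> lying over \<open>f\<close>. When
  \<open>m'\<close> is mono there is at most one top side of the square, and \<open>THE\<close>
  finds it as soon as \<open>f \<cdot> m\<close> factors through \<open>m'\<close>.\<close>

definition mono_square :: "('o, 'a) cat \<Rightarrow> 'a \<Rightarrow> 'a \<Rightarrow> 'a \<Rightarrow> 'a \<times> 'a \<times> 'a \<times> 'a" where
  "mono_square C m m' f =
     (m, m', THE g. g \<in> hom C (Dom C m) (Dom C m') \<and> m' \<cdot>\<^bsub>C\<^esub> g = f \<cdot>\<^bsub>C\<^esub> m, f)"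

context category
begin

lemma mono_cat_Obj: "Obj (mono_cat C) = {m. is_mono C m}"
  by (simp add: mono_cat_def)

lemma mono_cat_hom_iff:
  "t \<in> hom (mono_cat C) m m' \<longleftrightarrow> is_mono C m \<and> is_mono C m' \<and>
    (\<exists>g f. t = (m, m', g, f) \<and> g \<in> hom C (Dom C m) (Dom C m') \<and>
      f \<in> hom C (Cod C m) (Cod C m') \<and> f \<cdot> m = m' \<cdot> g)"
  unfolding hom_def[of "mono_cat C"] by (cases t) (auto simp: mono_cat_def)

lemma mono_cat_homE:
  assumes "t \<in> hom (mono_cat C) m m'"
  obtains g f where "t = (m, m', g, f)" "is_mono C m" "is_mono C m'"
    "g \<in> hom C (Dom C m) (Dom C m')" "f \<in> hom C (Cod C m) (Cod C m')" "f \<cdot> m = m' \<cdot> g"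
  using assms unfolding mono_cat_hom_iff by metis

text \<open>The top side of a square is determined by the bottom side \<open>f\<close>, as
  \<open>m'\<close> can be cancelled. Equations in \<open>mono_cat C\<close> are therefore checked
  below on the last component alone, which \<open>snd (snd (snd t))\<close> extracts.\<close>

lemma mono_cat_hom_eqI:
  assumes "s \<in> hom (mono_cat C) m m'" "t \<in> hom (mono_cat C) m m'"
    and "snd (snd (snd s)) = snd (snd (snd t))"
  shows "s = t"
proof -
  obtain g f where s: "s = (m, m', g, f)" "is_mono C m'" "g \<in> hom C (Dom C m) (Dom C m')" "f \<cdot> m = m' \<cdot> g"
    using assms(1) by (rule mono_cat_homE)
  obtain h f' where t: "t = (m, m', h, f')" "h \<in> hom C (Dom C m) (Dom C m')" "f' \<cdot> m = m' \<cdot> h"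
    using assms(2) by (rule mono_cat_homE)
  have "f' = f" using assms(3) s(1) t(1) by simp
  then have "g = h"
    using is_mono_cancel[OF s(2,3) t(2)] s(4) t(3) by metis
  with \<open>f' = f\<close> s(1) t(1) show ?thesis by simp
qed

lemma mono_cat_Comp:
  "snd (snd (snd (v \<cdot>\<^bsub>mono_cat C\<^esub> u))) = snd (snd (snd v)) \<cdot> snd (snd (snd u))"
  by (simp add: mono_cat_def split_beta)

lemma mono_square_hom:
  assumes m: "is_mono C m" "is_mono C m'" and f: "f \<in> hom C (Cod C m) (Cod C m')"
    and le: "factors_through C (f \<cdot> m) m'"
  shows "mono_square C m m' f \<in> hom (mono_cat C) m m'"
proof -
  obtain g where g: "g \<in> hom C (Dom C m) (Dom C m')" "m' \<cdot> g = f \<cdot> m"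
    using le comp_hom[OF is_mono_hom[OF m(1)] f] by (rule factors_throughE)
  have "(THE g. g \<in> hom C (Dom C m) (Dom C m') \<and> m' \<cdot> g = f \<cdot> m) = g"
  proof (rule the_equality)
    fix h assume h: "h \<in> hom C (Dom C m) (Dom C m') \<and> m' \<cdot> h = f \<cdot> m"
    then have "m' \<cdot> h = m' \<cdot> g" using g(2) by metis
    then show "h = g" using is_mono_cancel[OF m(2)] h g(1) by blast
  qed (use g in blast)
  then show ?thesis
    unfolding mono_cat_hom_iff mono_square_def using m f g by auto
qed

text \<open>Together with \<open>mono_square_hom\<close> this replaces commutative squares by arrows
  \<open>f\<close> such that \<open>f \<cdot> m\<close> factors through \<open>m'\<close>, the form
  in which the adjunction compares them with arrows of relations.\<close>

lemma mono_cat_hom_factors: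
  assumes "t \<in> hom (mono_cat C) m m'"
  shows "snd (snd (snd t)) \<in> hom C (Cod C m) (Cod C m')"
    and "factors_through C (snd (snd (snd t)) \<cdot> m) m'"
proof -
  obtain g f where t: "t = (m, m', g, f)" "is_mono C m" "is_mono C m'"
    "g \<in> hom C (Dom C m) (Dom C m')" "f \<in> hom C (Cod C m) (Cod C m')" "f \<cdot> m = m' \<cdot> g"
    using assms by (rule mono_cat_homE)
  show "snd (snd (snd t)) \<in> hom C (Cod C m) (Cod C m')"
    using t(1,5) by simp
  show "factors_through C (snd (snd (snd t)) \<cdot> m) m'"
    using factors_throughI[OF t(4) t(6)[symmetric] comp_hom[OF is_mono_hom[OF t(2)] t(5)]] t(1) by simp
qed

lemma mono_cat_Ident:
  assumes "m \<in> Obj (mono_cat C)"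
  shows "Ident (mono_cat C) m \<in> hom (mono_cat C) m m"
proof -
  have m: "is_mono C m" using assms by (simp add: mono_cat_Obj)
  note mh = is_mono_hom[OF m]
  have "Ident (mono_cat C) m = (m, m, Ident C (Dom C m), Ident C (Cod C m))"
    by (simp add: mono_cat_def)
  then show ?thesis
    unfolding mono_cat_hom_iff
    using m ident_hom[OF hom_Obj(1)[OF mh]] ident_hom[OF hom_Obj(2)[OF mh]]
      ident_left[OF mh] ident_right[OF mh] by simp
qed

lemma mono_cat_comp_hom:
  assumes "u \<in> hom (mono_cat C) m m'" "v \<in> hom (mono_cat C) m' m''"
  shows "v \<cdot>\<^bsub>mono_cat C\<^esub> u \<in> hom (mono_cat C) m m''"
proof -
  obtain g f where u: "u = (m, m', g, f)" "is_mono C m" "is_mono C m'"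
    "g \<in> hom C (Dom C m) (Dom C m')" "f \<in> hom C (Cod C m) (Cod C m')" "f \<cdot> m = m' \<cdot> g"
    using assms(1) by (rule mono_cat_homE)
  obtain g' f' where v: "v = (m', m'', g', f')" "is_mono C m'" "is_mono C m''"
    "g' \<in> hom C (Dom C m') (Dom C m'')" "f' \<in> hom C (Cod C m') (Cod C m'')" "f' \<cdot> m' = m'' \<cdot> g'"
    using assms(2) by (rule mono_cat_homE)
  have "(f' \<cdot> f) \<cdot> m = f' \<cdot> (f \<cdot> m)"
    by (rule comp_assoc[OF is_mono_hom[OF u(2)] u(5) v(5)])
  also have "\<dots> = (f' \<cdot> m') \<cdot> g"
    unfolding u(6) by (rule comp_assoc[OF u(4) is_mono_hom[OF u(3)] v(5), symmetric])
  also have "\<dots> = m'' \<cdot> (g' \<cdot> g)"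
    unfolding v(6) by (rule comp_assoc[OF u(4) v(4) is_mono_hom[OF v(3)]])
  finally have "(f' \<cdot> f) \<cdot> m = m'' \<cdot> (g' \<cdot> g)" .
  moreover have "v \<cdot>\<^bsub>mono_cat C\<^esub> u = (m, m'', g' \<cdot> g, f' \<cdot> f)"
    using u(1) v(1) by (simp add: mono_cat_def)
  ultimately show ?thesis
    unfolding mono_cat_hom_iff using u(2) v(3) comp_hom[OF u(4) v(4)] comp_hom[OF u(5) v(5)] by simp
qed

lemma category_mono_cat: "category (mono_cat C)"
proof
  fix t assume "t \<in> Arr (mono_cat C)"
  then show "Dom (mono_cat C) t \<in> Obj (mono_cat C)" "Cod (mono_cat C) t \<in> Obj (mono_cat C)"
    by (auto simp: mono_cat_def)
next
  fix m assume "m \<in> Obj (mono_cat C)"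
  then show "Ident (mono_cat C) m \<in> hom (mono_cat C) m m" by (rule mono_cat_Ident)
next
  fix u v m m' m'' assume "u \<in> hom (mono_cat C) m m'" "v \<in> hom (mono_cat C) m' m''"
  then show "v \<cdot>\<^bsub>mono_cat C\<^esub> u \<in> hom (mono_cat C) m m''" by (rule mono_cat_comp_hom)
next
  fix u m m' assume u: "u \<in> hom (mono_cat C) m m'"
  note uh = mono_cat_hom_factors(1)[OF u]
  have m: "m \<in> Obj (mono_cat C)" "m' \<in> Obj (mono_cat C)"
    using u unfolding mono_cat_Obj mono_cat_hom_iff by auto
  have id: "snd (snd (snd (Ident (mono_cat C) k))) = Ident C (Cod C k)" for k
    by (simp add: mono_cat_def)
  show "Ident (mono_cat C) m' \<cdot>\<^bsub>mono_cat C\<^esub> u = u"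
    by (rule mono_cat_hom_eqI[OF mono_cat_comp_hom[OF u mono_cat_Ident[OF m(2)]] u])
      (simp only: mono_cat_Comp id ident_left[OF uh])
  show "u \<cdot>\<^bsub>mono_cat C\<^esub> Ident (mono_cat C) m = u"
    by (rule mono_cat_hom_eqI[OF mono_cat_comp_hom[OF mono_cat_Ident[OF m(1)] u] u])
      (simp only: mono_cat_Comp id ident_right[OF uh])
next
  fix u v w a b c d
  assume u: "u \<in> hom (mono_cat C) a b" and v: "v \<in> hom (mono_cat C) b c" and w: "w \<in> hom (mono_cat C) c d"
  show "w \<cdot>\<^bsub>mono_cat C\<^esub> v \<cdot>\<^bsub>mono_cat C\<^esub> u = w \<cdot>\<^bsub>mono_cat C\<^esub> (v \<cdot>\<^bsub>mono_cat C\<^esub> u)"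
    by (rule mono_cat_hom_eqI[OF mono_cat_comp_hom[OF u mono_cat_comp_hom[OF v w]]
          mono_cat_comp_hom[OF mono_cat_comp_hom[OF u v] w]])
      (simp only: mono_cat_Comp comp_assoc[OF mono_cat_hom_factors(1)[OF u]
          mono_cat_hom_factors(1)[OF v] mono_cat_hom_factors(1)[OF w]])
qed

end

section \<open>The category of \<tau>-relations\<close>

locale relation_subcategory = pointed_complete_category C for C :: "('o, 'a) cat" (structure) +
  fixes T :: "('o \<times> 'a) set"
  assumes relations: "T \<subseteq> Obj (rel_cat C)"
begin

abbreviation "TauC \<equiv> full_subcat (rel_cat C) T"

lemma relationD:
  assumes "X \<in> T"
  shows "fst X \<in> Obj C" "is_mono C (snd X)" "snd X \<in> monos_into C (prd C (fst X) (fst X))"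
    "snd X \<in> hom C (Dom C (snd X)) (prd C (fst X) (fst X))"
proof -
  show *: "fst X \<in> Obj C" "snd X \<in> monos_into C (prd C (fst X) (fst X))"
    using assms relations by (auto simp: rel_cat_def Let_def)
  then show "is_mono C (snd X)"
    by (simp add: monos_into_def)
  show "snd X \<in> hom C (Dom C (snd X)) (prd C (fst X) (fst X))"
    using monos_into_hom[OF *(2)] .
qed

lemma tau_hom_iff:
  "t \<in> hom TauC X Y \<longleftrightarrow> X \<in> T \<and> Y \<in> T \<and> (\<exists>f. t = (X, Y, f) \<and> f \<in> hom C (fst X) (fst Y) \<and>
     factors_through C (prod_map C f f \<cdot> snd X) (snd Y))"
proof -
  obtain X' Y' f where t: "t = (X', Y', f)" by (cases t) auto
  then show ?thesis
    using relationD(1,3)[of X] relationD(1,3)[of Y] unfolding t hom_def[of TauC]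
    by (auto simp: full_subcat_def rel_cat_def Let_def split_beta)
qed

lemma tau_homE:
  assumes "t \<in> hom TauC X Y"
  obtains f where "t = (X, Y, f)" "X \<in> T" "Y \<in> T" "f \<in> hom C (fst X) (fst Y)"
    "factors_through C (prod_map C f f \<cdot> snd X) (snd Y)"
  using assms unfolding tau_hom_iff by metis

lemma tau_Comp: "(Y, Z, g) \<cdot>\<^bsub>TauC\<^esub> (X, Y', f) = (X, Z, g \<cdot> f)"
  by (simp add: full_subcat_def rel_cat_def Let_def)

lemma tau_Obj: "Obj TauC = T"
  by (simp add: full_subcat_def)

lemma tau_Ident: "Ident TauC X = (X, X, Ident C (fst X))"
  by (cases X) (simp add: full_subcat_def rel_cat_def Let_def)

lemma tau_ident_hom:
  assumes "X \<in> T"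
  shows "(X, X, Ident C (fst X)) \<in> hom TauC X X"
proof -
  note X = relationD[OF assms]
  have "prod_map C (Ident C (fst X)) (Ident C (fst X)) \<cdot> snd X = snd X"
    using prod_map_ident[OF X(1,1)] ident_left[OF X(4)] by simp
  moreover have "factors_through C (snd X) (snd X)"
    using factors_throughI[OF ident_hom[OF hom_Obj(1)[OF X(4)]] ident_right[OF X(4)] X(4)] .
  ultimately show ?thesis
    unfolding tau_hom_iff using assms ident_hom[OF X(1)] by simp
qed

text \<open>The factorization witnessing compatibility of the first arrow is carried along
  \<open>g \<times> g\<close> and followed by the one for the second; functoriality of
  \<open>prod_map\<close> identifies the result.\<close>

lemma tau_comp_hom:
  assumes "s \<in> hom TauC X Y" "t \<in> hom TauC Y Z"
  shows "t \<cdot>\<^bsub>TauC\<^esub> s \<in> hom TauC X Z"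
proof -
  obtain f where s: "s = (X, Y, f)" "X \<in> T" "Y \<in> T" "f \<in> hom C (fst X) (fst Y)"
    "factors_through C (prod_map C f f \<cdot> snd X) (snd Y)"
    using assms(1) by (rule tau_homE)
  obtain g where t: "t = (Y, Z, g)" "Y \<in> T" "Z \<in> T" "g \<in> hom C (fst Y) (fst Z)"
    "factors_through C (prod_map C g g \<cdot> snd Y) (snd Z)"
    using assms(2) by (rule tau_homE)
  note ff = prod_map_hom[OF s(4,4)] and gg = prod_map_hom[OF t(4,4)]
  have "factors_through C (prod_map C g g \<cdot> (prod_map C f f \<cdot> snd X)) (prod_map C g g \<cdot> snd Y)"
    using factors_through_comp_left[OF s(5) relationD(4)[OF s(3)] gg] .
  then have "factors_through C (prod_map C g g \<cdot> (prod_map C f f \<cdot> snd X)) (snd Z)"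
    using factors_through_trans t(5) hom_Arr[OF relationD(4)[OF t(3)]] by blast
  moreover have "prod_map C (g \<cdot> f) (g \<cdot> f) \<cdot> snd X = prod_map C g g \<cdot> (prod_map C f f \<cdot> snd X)"
    unfolding prod_map_comp[OF s(4,4) t(4,4)] by (rule comp_assoc[OF relationD(4)[OF s(2)] ff gg])
  ultimately show ?thesis
    unfolding tau_hom_iff s(1) t(1) tau_Comp using s(2) t(3) comp_hom[OF s(4) t(4)] by simp
qed

lemma category_tau: "category TauC"
proof
  fix t assume "t \<in> Arr TauC"
  then show "Dom TauC t \<in> Obj TauC" "Cod TauC t \<in> Obj TauC"
    by (auto simp: full_subcat_def)
next
  fix X assume "X \<in> Obj TauC"
  then show "Ident TauC X \<in> hom TauC X X"
    unfolding tau_Obj tau_Ident by (rule tau_ident_hom)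
next
  fix s t X Y Z assume "s \<in> hom TauC X Y" "t \<in> hom TauC Y Z"
  then show "t \<cdot>\<^bsub>TauC\<^esub> s \<in> hom TauC X Z" by (rule tau_comp_hom)
next
  fix s X Y assume "s \<in> hom TauC X Y"
  then obtain f where s: "s = (X, Y, f)" "f \<in> hom C (fst X) (fst Y)" by (rule tau_homE)
  show "Ident TauC Y \<cdot>\<^bsub>TauC\<^esub> s = s" "s \<cdot>\<^bsub>TauC\<^esub> Ident TauC X = s"
    unfolding s(1) tau_Ident tau_Comp ident_left[OF s(2)] ident_right[OF s(2)] by (rule refl)+
next
  fix s t u X Y Z W
  assume "s \<in> hom TauC X Y" "t \<in> hom TauC Y Z" "u \<in> hom TauC Z W"
  then obtain f g h where "s = (X, Y, f)" "f \<in> hom C (fst X) (fst Y)" "t = (Y, Z, g)"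
    "g \<in> hom C (fst Y) (fst Z)" "u = (Z, W, h)" "h \<in> hom C (fst Z) (fst W)"
    by (meson tau_homE)
  then show "u \<cdot>\<^bsub>TauC\<^esub> t \<cdot>\<^bsub>TauC\<^esub> s = u \<cdot>\<^bsub>TauC\<^esub> (t \<cdot>\<^bsub>TauC\<^esub> s)"
    using comp_assoc by (simp only: tau_Comp)
qed

section \<open>Normalization\<close>

lemma norm_pullback_is_pullback:
  assumes X: "X \<in> T"
  shows "is_pullback C (zero_one C (fst X)) (snd X) (fst (norm_pullback C X)) (snd (norm_pullback C X))"
proof -
  have "\<exists>z. case z of (m, q) \<Rightarrow> is_pullback C (zero_one C (fst X)) (snd X) m q"
    using ex_pullback[OF finitely_complete zero_one_hom[OF relationD(1)[OF X]] relationD(4)[OF X]] by auto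
  then have "case norm_pullback C X of (m, q) \<Rightarrow> is_pullback C (zero_one C (fst X)) (snd X) m q"
    unfolding norm_pullback_def split_beta by (rule someI_ex)
  then show ?thesis by (simp add: split_beta)
qed

lemma norm_omap: "omap (normalization C) X = fst (norm_pullback C X)"
  by (simp add: normalization_def)

lemma norm_mono:
  assumes X: "X \<in> T"
  shows "is_mono C (omap (normalization C) X)"
    and "Cod C (omap (normalization C) X) = fst X"
  using is_pullback_mono[OF norm_pullback_is_pullback[OF X] relationD(2)[OF X]]
    is_pullback_hom(3)[OF norm_pullback_is_pullback[OF X]]
    hom_Dom[OF zero_one_hom[OF relationD(1)[OF X]]] hom_Cod
  by (simp_all add: norm_omap)

text \<open>This is the universal property of the pullback along
  \<open>\<langle>0,1\<rangle>\<close>; it turns a condition on the chosen normalization into one on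
  the relation itself.\<close>

lemma norm_factors_iff:
  assumes X: "X \<in> T" and u: "u \<in> hom C Y (fst X)"
  shows "factors_through C u (omap (normalization C) X) \<longleftrightarrow>
    factors_through C (zero_one C (fst X) \<cdot> u) (snd X)"
  unfolding norm_omap
  by (rule is_pullback_factors_iff[OF norm_pullback_is_pullback[OF X]])
    (use u hom_Dom[OF zero_one_hom[OF relationD(1)[OF X]]] in simp)

text \<open>Both definite descriptions in \<open>normalization\<close> are justified here:
  \<open>h\<close> is unique because the target relation is mono, and \<open>g\<close> by the
  universal property of the pullback defining the target normalization.\<close>

lemma norm_amap_hom:
  assumes "t \<in> hom TauC X Y"
  shows "amap (normalization C) t \<in>
      hom (mono_cat C) (omap (normalization C) X) (omap (normalization C) Y)"
    and "snd (snd (snd (amap (normalization C) t))) = snd (snd t)"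
proof -
  obtain f where t: "t = (X, Y, f)" "X \<in> T" "Y \<in> T" "f \<in> hom C (fst X) (fst Y)"
    "factors_through C (prod_map C f f \<cdot> snd X) (snd Y)"
    using assms by (rule tau_homE)
  obtain m q where mq: "norm_pullback C X = (m, q)" by (cases "norm_pullback C X")
  obtain m' q' where mq': "norm_pullback C Y = (m', q')" by (cases "norm_pullback C Y")
  have pb: "is_pullback C (zero_one C (fst X)) (snd X) m q"
    using norm_pullback_is_pullback[OF t(2)] mq by simp
  have pb': "is_pullback C (zero_one C (fst Y)) (snd Y) m' q'"
    using norm_pullback_is_pullback[OF t(3)] mq' by simp
  note r = relationD[OF t(2)] and r' = relationD[OF t(3)]
  note z = zero_one_hom[OF r(1)] and z' = zero_one_hom[OF r'(1)]
  note pbh = is_pullback_hom[OF pb, unfolded hom_Dom[OF z]]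
  note pbh' = is_pullback_hom[OF pb', unfolded hom_Dom[OF z']]
  note ff = prod_map_hom[OF t(4,4)]
  define h where "h = (THE h. h \<in> hom C (Dom C (snd X)) (Dom C (snd Y)) \<and>
    snd Y \<cdot> h = prod_map C f f \<cdot> snd X)"
  define g where "g = (THE g. g \<in> hom C (Dom C m) (Dom C m') \<and> m' \<cdot> g = f \<cdot> m \<and> q' \<cdot> g = h \<cdot> q)"
  have amap: "amap (normalization C) t = (m, m', g, f)"
    by (simp add: normalization_def t(1) mq mq' h_def g_def)
  have "\<exists>!h. h \<in> hom C (Dom C (snd X)) (Dom C (snd Y)) \<and> snd Y \<cdot> h = prod_map C f f \<cdot> snd X"
  proof -
    obtain k where k: "k \<in> hom C (Dom C (snd X)) (Dom C (snd Y))" "snd Y \<cdot> k = prod_map C f f \<cdot> snd X"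
      using t(5) comp_hom[OF r(4) ff] by (rule factors_throughE)
    then show ?thesis
      using is_mono_cancel[OF r'(2)] by metis
  qed
  from theI'[OF this]
  have h: "h \<in> hom C (Dom C (snd X)) (Dom C (snd Y))" "snd Y \<cdot> h = prod_map C f f \<cdot> snd X"
    by (simp_all add: h_def)
  \<comment> \<open>The cone condition for \<open>f \<cdot> m\<close> and \<open>h \<cdot> q\<close>
    combines naturality of \<open>\<langle>0,1\<rangle>\<close>, the pullback square of
    \<open>X\<close> and the defining equation of \<open>h\<close>.\<close>
  have "zero_one C (fst Y) \<cdot> (f \<cdot> m) = (prod_map C f f \<cdot> zero_one C (fst X)) \<cdot> m"
    unfolding zero_one_natural[OF t(4)] by (rule comp_assoc[OF pbh(3) t(4) z', symmetric])
  also have "\<dots> = prod_map C f f \<cdot> (snd X \<cdot> q)"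
    unfolding pbh(5)[symmetric] by (rule comp_assoc[OF pbh(3) z ff])
  also have "\<dots> = (prod_map C f f \<cdot> snd X) \<cdot> q"
    by (rule comp_assoc[OF pbh(4) r(4) ff, symmetric])
  also have "\<dots> = snd Y \<cdot> (h \<cdot> q)"
    unfolding h(2)[symmetric] by (rule comp_assoc[OF pbh(4) h(1) r'(4)])
  finally have "\<exists>!g. g \<in> hom C (Dom C m) (Dom C m') \<and> m' \<cdot> g = f \<cdot> m \<and> q' \<cdot> g = h \<cdot> q"
    by (intro is_pullback_universal[OF pb' _ comp_hom[OF pbh(4) h(1)]])
      (simp_all only: hom_Dom[OF z'] comp_hom[OF pbh(3) t(4)])
  from theI'[OF this]
  have g: "g \<in> hom C (Dom C m) (Dom C m')" "m' \<cdot> g = f \<cdot> m"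
    by (simp_all add: g_def)
  have "is_mono C m" "is_mono C m'" "Cod C m = fst X" "Cod C m' = fst Y"
    using norm_mono[OF t(2)] norm_mono[OF t(3)] mq mq' by (simp_all add: norm_omap)
  then have "(m, m', g, f) \<in> hom (mono_cat C) m m'"
    unfolding mono_cat_hom_iff using g t(4) by simp
  then show "amap (normalization C) t \<in>
      hom (mono_cat C) (omap (normalization C) X) (omap (normalization C) Y)"
    by (simp add: amap norm_omap mq mq')
  show "snd (snd (snd (amap (normalization C) t))) = snd (snd t)"
    unfolding amap by (simp add: t(1))
qed

lemma is_functor_normalization: "is_functor TauC (mono_cat C) (normalization C)"
  unfolding is_functor_def
proof (intro conjI allI ballI)
  show "category TauC" "category (mono_cat C)"
    using category_tau category_mono_cat by blast+
  fix X assume "X \<in> Obj TauC"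
  then have X: "X \<in> T" by (simp add: tau_Obj)
  show NX: "omap (normalization C) X \<in> Obj (mono_cat C)"
    using norm_mono[OF X] by (simp add: mono_cat_Obj)
  show "amap (normalization C) (Ident TauC X) = Ident (mono_cat C) (omap (normalization C) X)"
    unfolding tau_Ident
    by (rule mono_cat_hom_eqI[OF norm_amap_hom(1)[OF tau_ident_hom[OF X]] mono_cat_Ident[OF NX]])
      (use norm_amap_hom(2)[OF tau_ident_hom[OF X]] norm_mono[OF X] in \<open>simp add: mono_cat_def\<close>)
next
  fix X Y t assume "t \<in> hom TauC X Y"
  then show "amap (normalization C) t \<in>
      hom (mono_cat C) (omap (normalization C) X) (omap (normalization C) Y)"
    by (rule norm_amap_hom)
next
  fix X Y Z s t assume s: "s \<in> hom TauC X Y" and t: "t \<in> hom TauC Y Z"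
  \<comment> \<open>Normalization leaves the base arrow unchanged, so preservation of composites
    only concerns base arrows.\<close>
  have "snd (snd (t \<cdot>\<^bsub>TauC\<^esub> s)) = snd (snd t) \<cdot> snd (snd s)"
    using tau_Comp by (metis prod.collapse snd_conv)
  then show "amap (normalization C) (t \<cdot>\<^bsub>TauC\<^esub> s) =
      amap (normalization C) t \<cdot>\<^bsub>mono_cat C\<^esub> amap (normalization C) s"
    by (intro mono_cat_hom_eqI[OF norm_amap_hom(1)[OF tau_comp_hom[OF s t]]
          mono_cat_comp_hom[OF norm_amap_hom(1)[OF s] norm_amap_hom(1)[OF t]]])
      (simp only: mono_cat_Comp norm_amap_hom(2)[OF s] norm_amap_hom(2)[OF t]
        norm_amap_hom(2)[OF tau_comp_hom[OF s t]])
qed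

section \<open>The adjunction\<close>

lemma intersection_adjoint_iff:
  assumes stable: "pullback_stable C T" and m: "is_mono C m" and Y: "Y \<in> T"
    and r: "is_intersection C (prd C (Cod C m) (Cod C m)) (tau_relations_above C T m) (\<lambda>s. s) r"
    and f: "f \<in> hom C (Cod C m) (fst Y)"
  shows "factors_through C (prod_map C f f \<cdot> r) (snd Y) \<longleftrightarrow>
    factors_through C (f \<cdot> m) (omap (normalization C) Y)"
proof -
  define A where "A = Cod C m"
  note f = f[folded A_def] and r = r[folded A_def]
  have mh: "m \<in> hom C (Dom C m) A" using is_mono_hom[OF m] A_def by simp
  note A = hom_Obj(1)[OF f] and Yh = relationD(4)[OF Y]
  note ff = prod_map_hom[OF f f]
  have rh: "r \<in> hom C (Dom C r) (prd C A A)"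
    using is_intersection_monos_into[OF r] monos_into_hom by blast
  note zm = comp_hom[OF mh zero_one_hom[OF A]]
  \<comment> \<open>Each member of the intersected family admits such a factorization by definition,
    hence so does the intersection.\<close>
  have above: "factors_through C (zero_one C A \<cdot> m) r"
    unfolding is_intersection_factors_iff[OF r zm]
    by (simp add: tau_relations_above_def A_def)
  have "prod_map C f f \<cdot> (zero_one C A \<cdot> m) = (zero_one C (fst Y) \<cdot> f) \<cdot> m"
    unfolding zero_one_natural[OF f, symmetric]
    by (rule comp_assoc[OF mh zero_one_hom[OF A] ff, symmetric])
  also have "\<dots> = zero_one C (fst Y) \<cdot> (f \<cdot> m)"
    by (rule comp_assoc[OF mh f zero_one_hom[OF hom_Obj(2)[OF f]]])
  finally have norm: "factors_through C (f \<cdot> m) (omap (normalization C) Y) \<longleftrightarrow>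
      factors_through C (prod_map C f f \<cdot> (zero_one C A \<cdot> m)) (snd Y)"
    using norm_factors_iff[OF Y comp_hom[OF mh f]] by simp
  show ?thesis
    unfolding norm
  proof
    assume "factors_through C (prod_map C f f \<cdot> r) (snd Y)"
    then show "factors_through C (prod_map C f f \<cdot> (zero_one C A \<cdot> m)) (snd Y)"
      using factors_through_trans[OF factors_through_comp_left[OF above rh ff]] hom_Arr[OF Yh] by blast
  next
    assume *: "factors_through C (prod_map C f f \<cdot> (zero_one C A \<cdot> m)) (snd Y)"
    \<comment> \<open>The assumption says exactly that \<open>\<langle>0,1\<rangle> m\<close>
      factors through \<open>p\<close>, and stability makes \<open>p\<close> a \<tau>-relation; so
      \<open>p\<close> is a member of the intersected family.\<close>
    obtain p q where pq: "is_pullback C (prod_map C f f) (snd Y) p q"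
      using ex_pullback[OF finitely_complete ff Yh] by blast
    have "factors_through C (zero_one C A \<cdot> m) p"
      using * is_pullback_factors_iff[OF pq] zm hom_Dom[OF ff] by simp
    moreover have "(A, p) \<in> T"
      using stable[unfolded pullback_stable_def, rule_format, of f A "fst Y" "snd Y" p q] f Y pq by simp
    ultimately have "p \<in> tau_relations_above C T m"
      by (simp add: tau_relations_above_def A_def)
    moreover have "factors_through C r r"
      using factors_throughI[OF ident_hom[OF hom_Obj(1)[OF rh]] ident_right[OF rh] rh] .
    ultimately have "factors_through C r p"
      using is_intersection_factors_iff[OF r rh] by blast
    then show "factors_through C (prod_map C f f \<cdot> r) (snd Y)"
      using is_pullback_factors_iff[OF pq] rh hom_Dom[OF ff] by simp
  qed
qed

text \<open>\<open>R\<close> is any choice of the intersections. On arrows the left adjoint keeps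
  the base arrow, so its identity and composition laws are immediate; compatibility with the chosen
  relations is what \<open>intersection_adjoint_iff\<close> provides.\<close>

lemma normalization_left_adjoint:
  assumes stable: "pullback_stable C T"
    and R: "\<And>m. is_mono C m \<Longrightarrow> (Cod C m, R m) \<in> T \<and>
      is_intersection C (prd C (Cod C m) (Cod C m)) (tau_relations_above C T m) (\<lambda>s. s) (R m)"
  shows "left_adjoint (mono_cat C) TauC
    \<lparr>omap = \<lambda>m. (Cod C m, R m), amap = \<lambda>(m, m', g, f). ((Cod C m, R m), (Cod C m', R m'), f)\<rparr>
    (normalization C)"
    (is "left_adjoint _ _ ?F ?N")
proof -
  have omapF: "omap ?F m = (Cod C m, R m)" for m by simp
  have amapF: "amap ?F t = (omap ?F m, omap ?F m', snd (snd (snd t)))"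
    if "t \<in> hom (mono_cat C) m m'" for t m m'
    using that unfolding mono_cat_hom_iff by auto
  have FT: "omap ?F m \<in> T" if "is_mono C m" for m
    using R[OF that] by simp
  have adj: "factors_through C (prod_map C f f \<cdot> R m) (snd Y) \<longleftrightarrow> factors_through C (f \<cdot> m) (omap ?N Y)"
    if "is_mono C m" "Y \<in> T" "f \<in> hom C (Cod C m) (fst Y)" for m Y f
    using intersection_adjoint_iff[OF stable that(1,2) _ that(3)] R[OF that(1)] by blast
  have adj_hom: "(omap ?F m, Y, f) \<in> hom TauC (omap ?F m) Y"
    if "is_mono C m" "Y \<in> T" "f \<in> hom C (Cod C m) (fst Y)" "factors_through C (f \<cdot> m) (omap ?N Y)" for m Y f
    unfolding tau_hom_iff using adj[OF that(1-3)] that FT[OF that(1)] by simp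
  \<comment> \<open>The unit is obtained as usual, by transposing the identity of the relation
    assigned to \<open>m\<close>.\<close>
  have unit: "factors_through C m (omap ?N (omap ?F m))" if m: "is_mono C m" for m
  proof -
    note mh = is_mono_hom[OF m]
    note i = ident_hom[OF hom_Obj(2)[OF mh]]
    have "factors_through C (prod_map C (Ident C (Cod C m)) (Ident C (Cod C m)) \<cdot> R m) (R m)"
      using tau_ident_hom[OF FT[OF m]] unfolding tau_hom_iff by simp
    then have "factors_through C (Ident C (Cod C m) \<cdot> m) (omap ?N (omap ?F m))"
      using adj[OF m FT[OF m], of "Ident C (Cod C m)"] i by simp
    then show ?thesis unfolding ident_left[OF mh] .
  qed
  have amapF_hom: "amap ?F t \<in> hom TauC (omap ?F m) (omap ?F m')"
    if t: "t \<in> hom (mono_cat C) m m'" for t m m'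
  proof -
    have m: "is_mono C m" "is_mono C m'" using t by (auto simp: mono_cat_hom_iff)
    note tf = mono_cat_hom_factors[OF t]
    \<comment> \<open>The square \<open>t\<close> is followed by the unit at \<open>m'\<close>;
      transposing back makes its base arrow compatible with \<open>R m\<close> and
      \<open>R m'\<close>.\<close>
    have "factors_through C (snd (snd (snd t)) \<cdot> m) (omap ?N (omap ?F m'))"
      using factors_through_trans[OF tf(2) unit[OF m(2)]]
        norm_mono(1)[OF FT[OF m(2)]] by (simp add: is_mono_def)
    then show ?thesis
      unfolding amapF[OF t] using adj_hom[OF m(1) FT[OF m(2)]] tf(1) by simp
  qed
  have functorF: "is_functor (mono_cat C) TauC ?F"
    unfolding is_functor_def
  proof (intro conjI allI ballI)
    show "category (mono_cat C)" "category TauC"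
      using category_tau category_mono_cat by blast+
    fix m assume m: "m \<in> Obj (mono_cat C)"
    then show "omap ?F m \<in> Obj TauC"
      using FT by (simp add: mono_cat_Obj tau_Obj)
    show "amap ?F (Ident (mono_cat C) m) = Ident TauC (omap ?F m)"
      unfolding amapF[OF mono_cat_Ident[OF m]] tau_Ident by (simp add: mono_cat_def)
  next
    fix m m' t assume "t \<in> hom (mono_cat C) m m'"
    then show "amap ?F t \<in> hom TauC (omap ?F m) (omap ?F m')" by (rule amapF_hom)
  next
    fix a b c s t assume s: "s \<in> hom (mono_cat C) a b" and t: "t \<in> hom (mono_cat C) b c"
    show "amap ?F (t \<cdot>\<^bsub>mono_cat C\<^esub> s) = amap ?F t \<cdot>\<^bsub>TauC\<^esub> amap ?F s"
      unfolding amapF[OF s] amapF[OF t] amapF[OF mono_cat_comp_hom[OF s t]] tau_Comp mono_cat_Comp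
      by (rule refl)
  qed
  \<comment> \<open>The bijection does not change the base arrow; only the witness of compatibility
    is replaced by the top side of a square.\<close>
  define \<phi> :: "'a \<Rightarrow> 'o \<times> 'a \<Rightarrow> ('o \<times> 'a) \<times> ('o \<times> 'a) \<times> 'a \<Rightarrow> 'a \<times> 'a \<times> 'a \<times> 'a"
    where "\<phi> = (\<lambda>m Y t. mono_square C m (omap ?N Y) (snd (snd t)))"
  have \<phi>_base: "snd (snd (snd (\<phi> m Y t))) = snd (snd t)" for m Y t
    by (simp add: \<phi>_def mono_square_def)
  have \<phi>_hom: "\<phi> m Y t \<in> hom (mono_cat C) m (omap ?N Y)"
    if m: "is_mono C m" and t: "t \<in> hom TauC (omap ?F m) Y" for m Y t
  proof -
    obtain f where f: "t = (omap ?F m, Y, f)" "Y \<in> T" "f \<in> hom C (fst (omap ?F m)) (fst Y)"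
      "factors_through C (prod_map C f f \<cdot> snd (omap ?F m)) (snd Y)"
      using t by (rule tau_homE)
    have fh: "f \<in> hom C (Cod C m) (fst Y)" using f(3) by simp
    show ?thesis
      unfolding \<phi>_def
      by (rule mono_square_hom[OF m norm_mono(1)[OF f(2)]])
        (use fh f adj[OF m f(2) fh] norm_mono(2)[OF f(2)] in simp_all)
  qed
  have "bij_betw (\<phi> m Y) (hom TauC (omap ?F m) Y) (hom (mono_cat C) m (omap ?N Y))"
    if m: "is_mono C m" and Y: "Y \<in> T" for m Y
    unfolding bij_betw_def
  proof (intro conjI inj_onI subset_antisym image_subsetI subsetI)
    fix s t assume s: "s \<in> hom TauC (omap ?F m) Y" and t: "t \<in> hom TauC (omap ?F m) Y"
      and "\<phi> m Y s = \<phi> m Y t"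
    then have "snd (snd s) = snd (snd t)" using \<phi>_base by metis
    with s t show "s = t" unfolding tau_hom_iff by auto
  next
    fix t assume "t \<in> hom TauC (omap ?F m) Y"
    then show "\<phi> m Y t \<in> hom (mono_cat C) m (omap ?N Y)" using \<phi>_hom[OF m] by blast
  next
    fix s assume s: "s \<in> hom (mono_cat C) m (omap ?N Y)"
    \<comment> \<open>The preimage has the same base arrow, made compatible by the converse
      direction of \<open>adj\<close>.\<close>
    let ?t = "(omap ?F m, Y, snd (snd (snd s)))"
    have t: "?t \<in> hom TauC (omap ?F m) Y"
      using adj_hom[OF m Y] mono_cat_hom_factors[OF s] norm_mono(2)[OF Y] by simp
    have "\<phi> m Y ?t = s"
      by (rule mono_cat_hom_eqI[OF \<phi>_hom[OF m t] s]) (simp only: \<phi>_base snd_conv)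
    then show "s \<in> \<phi> m Y ` hom TauC (omap ?F m) Y"
      using t by (rule image_eqI[OF sym])
  qed
  moreover have "\<phi> m' Y' (v \<cdot>\<^bsub>TauC\<^esub> t \<cdot>\<^bsub>TauC\<^esub> amap ?F u) =
      amap ?N v \<cdot>\<^bsub>mono_cat C\<^esub> \<phi> m Y t \<cdot>\<^bsub>mono_cat C\<^esub> u"
    if m: "is_mono C m" "is_mono C m'" and u: "u \<in> hom (mono_cat C) m' m"
      and v: "v \<in> hom TauC Y Y'" and t: "t \<in> hom TauC (omap ?F m) Y" for m m' Y Y' u v t
  proof (rule mono_cat_hom_eqI)
    show "\<phi> m' Y' (v \<cdot>\<^bsub>TauC\<^esub> t \<cdot>\<^bsub>TauC\<^esub> amap ?F u) \<in> hom (mono_cat C) m' (omap ?N Y')"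
      using \<phi>_hom[OF m(2) tau_comp_hom[OF amapF_hom[OF u] tau_comp_hom[OF t v]]] .
    show "amap ?N v \<cdot>\<^bsub>mono_cat C\<^esub> \<phi> m Y t \<cdot>\<^bsub>mono_cat C\<^esub> u \<in> hom (mono_cat C) m' (omap ?N Y')"
      using mono_cat_comp_hom[OF u mono_cat_comp_hom[OF \<phi>_hom[OF m(1) t] norm_amap_hom(1)[OF v]]] .
    obtain f where t': "t = (omap ?F m, Y, f)" using t by (rule tau_homE)
    obtain g where v': "v = (Y, Y', g)" using v by (rule tau_homE)
    \<comment> \<open>Since every map involved preserves base arrows, naturality holds because both
      sides have the same composite, bracketed in the same way, as base arrow.\<close>
    from t' v' show "snd (snd (snd (\<phi> m' Y' (v \<cdot>\<^bsub>TauC\<^esub> t \<cdot>\<^bsub>TauC\<^esub> amap ?F u)))) =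
        snd (snd (snd (amap ?N v \<cdot>\<^bsub>mono_cat C\<^esub> \<phi> m Y t \<cdot>\<^bsub>mono_cat C\<^esub> u)))"
      unfolding mono_cat_Comp \<phi>_base norm_amap_hom(2)[OF v] amapF[OF u]
      by (simp only: tau_Comp snd_conv)
  qed
  ultimately show ?thesis
    unfolding left_adjoint_def tau_Obj mono_cat_Obj using functorF is_functor_normalization
    by (intro conjI exI[of _ \<phi>]) auto
qed

end

section \<open>The left adjoint given by intersections\<close>

theorem theorem1:
  fixes C :: "('o, 'a) cat" and U :: "'i set set" and T :: "('o \<times> 'a) set"
  assumes "category C"
    and "smallness U"
    and "pointed C"
    and "well_powered U C"
    and "finitely_complete C"
    and "has_intersections U C"
    and "T \<subseteq> Obj (rel_cat C)"
    and "pullback_stable C T"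
    and "intersection_closed U C T"
  shows "\<exists>F. left_adjoint (mono_cat C) (full_subcat (rel_cat C) T) F (normalization C) \<and>
    (\<forall>m\<in>Obj (mono_cat C). \<exists>r. omap F m = (Cod C m, r) \<and>
       is_intersection C (prd C (Cod C m) (Cod C m)) (tau_relations_above C T m) (\<lambda>s. s) r)"
proof -
  interpret category C by fact
  interpret relation_subcategory C T
    by unfold_locales fact+
  have "\<exists>r. (Cod C m, r) \<in> T \<and>
      is_intersection C (prd C (Cod C m) (Cod C m)) (tau_relations_above C T m) (\<lambda>s. s) r"
    if m: "is_mono C m" for m
  proof -
    have A: "Cod C m \<in> Obj C" using hom_Obj(2)[OF is_mono_hom[OF m]] .
    have "(Cod C m, s) \<in> T" if "s \<in> tau_relations_above C T m" for s
      using that by (simp add: tau_relations_above_def)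
    moreover from this have "tau_relations_above C T m \<subseteq> monos_into C (prd C (Cod C m) (Cod C m))"
      using relationD(3) by fastforce
    ultimately show ?thesis
      using ex_intersection_closed[OF assms(2,4,6,9) A prd_Obj[OF A A]] by blast
  qed
  \<comment> \<open>An intersection is determined only up to isomorphism, so one is selected for all
    monomorphisms at once by the axiom of choice.\<close>
  then obtain R where R: "\<And>m. is_mono C m \<Longrightarrow> (Cod C m, R m) \<in> T \<and>
      is_intersection C (prd C (Cod C m) (Cod C m)) (tau_relations_above C T m) (\<lambda>s. s) (R m)"
    by metis
  have "\<forall>m\<in>Obj (mono_cat C). is_intersection C (prd C (Cod C m) (Cod C m))
      (tau_relations_above C T m) (\<lambda>s. s) (R m)"
    using R by (simp add: mono_cat_Obj)
  then show ?thesis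
    by (intro exI[of _ "\<lparr>omap = \<lambda>m. (Cod C m, R m),
        amap = \<lambda>(m, m', g, f). ((Cod C m, R m), (Cod C m', R m'), f)\<rparr>"]
        conjI[OF normalization_left_adjoint[OF assms(8) R]]) simp_all
qed

end
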